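(* For $p>1$, let $$C_{GN}=2^{\frac{3p-1}{2}}\max\{C_{1,p+1},C_{\frac12,p+1}\}.$$ Then, for any $c\ge1$, $\delta\in(0,1]$ and $u\in H^{1/2}(\mathbb{R})$, we have $$\|u\|_{L^{p+1}(\mathbb{R})}^{p+1}\leq C_{GN}\left\{\|u\|_{L^2(\mathbb{R})}^{\frac{p+3}{2}}\|\sqrt{\mathcal{H}_c}P_{\le c\delta}u\|_{L^2(\mathbb{R})}^{\frac{p-1}{2}}+\frac{1}{(c\delta)^{\frac{p-1}{2}}}\|u\|_{L^2(\mathbb{R})}^2\|\sqrt{\mathcal{H}_c}P_{>c\delta}u\|_{L^2(\mathbb{R})}^{p-1}\right\}.$$
   Context: $\mathcal{H}_c=\sqrt{-c^2\partial_x^2+\frac{c^4}{4}}-\frac{c^2}{2}$ is the Fourier multiplier with symbol $\sqrt{c^2|\xi|^2+\frac{c^4}{4}}-\frac{c^2}{2}$ and $\sqrt{\mathcal{H}_c}$ is the multiplier with the square root of this symbol (Fourier transform normalized so that $\partial_x$ corresponds to $i\xi$). The frequency projections are $P_{\le c\delta}u=(\mathbf{1}_{|\cdot|\le c\delta}\hat u)^\vee$ and $P_{>c\delta}u=u-P_{\le c\delta}u$. The constants $C_{1,p+1}$ and $C_{\frac12,p+1}$ are the sharp (smallest) constants in the Gagliardo-Nirenberg inequalities $$\|u\|_{L^{p+1}(\mathbb{R})}^{p+1}\le C_{1,p+1}\|u\|_{L^2}^{\frac{p+3}{2}}\|\partial_xu\|_{L^2}^{\frac{p-1}{2}},\qquad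 \|u\|_{L^{p+1}(\mathbb{R})}^{p+1}\le C_{\frac12,p+1}\|u\|_{L^2}^{2}\||\partial_x|^{1/2}u\|_{L^2}^{p-1}$$ for $u\in H^1(\mathbb{R})$ and $u\in H^{1/2}(\mathbb{R})$ respectively. *)

theory Defs
  imports "HOL-Analysis.Analysis"
begin

section \<open>The \<open>L\<^sup>2\<close> Fourier transform and Fourier multipliers on the line\<close>

text \<open>Elements of \<open>L\<^sup>2(\<real>)\<close> are represented by Borel measurable complex-valued functions;
  every operator below is determined up to equality almost everywhere.\<close>

definition in_L2 :: "(real \<Rightarrow> complex) \<Rightarrow> bool" where
  "in_L2 u \<longleftrightarrow> u \<in> borel_measurable lborel \<and> (\<integral>\<^sup>+x. ennreal ((cmod (u x))\<^sup>2) \<partial>lborel) < \<infinity>"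

definition L2_norm :: "(real \<Rightarrow> complex) \<Rightarrow> real" where
  "L2_norm u = sqrt (LINT x|lborel. (cmod (u x))\<^sup>2)"

text \<open>\<open>\<parallel>u\<parallel>\<^sup>q\<close> for the \<open>L\<^sup>q(\<real>)\<close> norm; the value is infinite iff a measurable \<open>u\<close> is not in \<open>L\<^sup>q(\<real>)\<close>.\<close>

definition Lq_norm_pow :: "real \<Rightarrow> (real \<Rightarrow> complex) \<Rightarrow> ennreal" where
  "Lq_norm_pow q u = (\<integral>\<^sup>+x. ennreal (cmod (u x) powr q) \<partial>lborel)"

text \<open>\<open>v\<close> is the Fourier transform of \<open>u \<in> L\<^sup>2(\<real>)\<close>, i.e. the \<open>L\<^sup>2\<close> limit as \<open>R \<rightarrow> \<infinity>\<close> of the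
  integrals of \<open>exp (- \<i> x \<xi>) u(x)\<close> over \<open>[-R, R]\<close>. No factor of \<open>2 \<pi>\<close> is included:
  multipliers do not depend on it.\<close>

definition has_fourier_transform :: "(real \<Rightarrow> complex) \<Rightarrow> (real \<Rightarrow> complex) \<Rightarrow> bool" where
  "has_fourier_transform u v \<longleftrightarrow> in_L2 u \<and> in_L2 v \<and>
     ((\<lambda>R. \<integral>\<^sup>+\<xi>. ennreal ((cmod (v \<xi> - (LINT x:{-R..R}|lborel. cis (- (x * \<xi>)) * u x)))\<^sup>2) \<partial>lborel)
        \<longlongrightarrow> 0) at_top"

text \<open>The choice is unique up to null sets, and meaningful whenever \<open>m\<close> times the transform of
  \<open>u\<close> is in \<open>L\<^sup>2(\<real>)\<close>.\<close>

definition fourier_multiplier :: "(real \<Rightarrow> complex) \<Rightarrow> (real \<Rightarrow> complex) \<Rightarrow> real \<Rightarrow> complex" where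
  "fourier_multiplier m u =
     (SOME w. \<exists>v. has_fourier_transform u v \<and> has_fourier_transform w (\<lambda>\<xi>. m \<xi> * v \<xi>))"

definition in_Sobolev :: "real \<Rightarrow> (real \<Rightarrow> complex) \<Rightarrow> bool" where
  "in_Sobolev s u \<longleftrightarrow> (\<exists>v. has_fourier_transform u v \<and>
     (\<integral>\<^sup>+\<xi>. ennreal ((1 + \<xi>\<^sup>2) powr s * (cmod (v \<xi>))\<^sup>2) \<partial>lborel) < \<infinity>)"

definition dx :: "(real \<Rightarrow> complex) \<Rightarrow> real \<Rightarrow> complex" where
  "dx = fourier_multiplier (\<lambda>\<xi>. \<i> * complex_of_real \<xi>)"

definition abs_dx_half :: "(real \<Rightarrow> complex) \<Rightarrow> real \<Rightarrow> complex" where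
  "abs_dx_half = fourier_multiplier (\<lambda>\<xi>. complex_of_real (\<bar>\<xi>\<bar> powr (1/2)))"

definition H_symbol :: "real \<Rightarrow> real \<Rightarrow> real" where
  "H_symbol c \<xi> = sqrt (c\<^sup>2 * \<bar>\<xi>\<bar>\<^sup>2 + c ^ 4 / 4) - c\<^sup>2 / 2"

definition sqrt_H :: "real \<Rightarrow> (real \<Rightarrow> complex) \<Rightarrow> real \<Rightarrow> complex" where
  "sqrt_H c = fourier_multiplier (\<lambda>\<xi>. complex_of_real (sqrt (H_symbol c \<xi>)))"

definition P_low :: "real \<Rightarrow> (real \<Rightarrow> complex) \<Rightarrow> real \<Rightarrow> complex" where
  "P_low a = fourier_multiplier (indicator {\<xi>. \<bar>\<xi>\<bar> \<le> a})"

definition P_high :: "real \<Rightarrow> (real \<Rightarrow> complex) \<Rightarrow> real \<Rightarrow> complex" where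
  "P_high a u = (\<lambda>x. u x - P_low a u x)"

section \<open>Sharp Gagliardo--Nirenberg constants\<close>

text \<open>Both are indexed by the exponent \<open>p\<close> of the nonlinearity, so they are
  \<open>C\<^bsub>1,p+1\<^esub>\<close> and \<open>C\<^bsub>1/2,p+1\<^esub>\<close>. The infimum is taken in \<open>[0, \<infinity>]\<close>; it is attained,
  since the admissible constants form a closed set, and finite by the
  Gagliardo--Nirenberg inequalities.\<close>

definition GN_const_one :: "real \<Rightarrow> ennreal" where
  "GN_const_one p = Inf {C. \<forall>u. in_Sobolev 1 u \<longrightarrow>
     Lq_norm_pow (p + 1) u
       \<le> C * ennreal (L2_norm u powr ((p + 3) / 2) * L2_norm (dx u) powr ((p - 1) / 2))}"

definition GN_const_half :: "real \<Rightarrow> ennreal" where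
  "GN_const_half p = Inf {C. \<forall>u. in_Sobolev (1/2) u \<longrightarrow>
     Lq_norm_pow (p + 1) u
       \<le> C * ennreal ((L2_norm u)\<^sup>2 * L2_norm (abs_dx_half u) powr (p - 1))}"

definition C_GN :: "real \<Rightarrow> ennreal" where
  "C_GN p = ennreal (2 powr ((3 * p - 1) / 2)) * max (GN_const_one p) (GN_const_half p)"

end

theory Submission
  imports Defs "HOL-Probability.Characteristic_Functions"
begin

text \<open>
  The idea is to cut \<open>u\<close> at the frequency \<open>a = c \<delta>\<close>, which does not exceed the scale \<open>c\<close> at which
  the symbol \<open>H\<close> of \<open>\<H>\<^sub>c\<close> passes from parabolic to linear growth. For \<open>\<bar>\<xi>\<bar> \<le> c\<close> one has \<open>\<xi>\<^sup>2 \<le> 2 H(\<xi>)\<close>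
  (lemma \<open>H_symbol_ge_low\<close>), so \<open>\<surd>\<H>\<^sub>c\<close> controls \<open>\<partial>\<^sub>x\<close> on the low frequencies; for
  \<open>\<bar>\<xi>\<bar> \<ge> a\<close> one has \<open>a \<bar>\<xi>\<bar> \<le> 2 H(\<xi>)\<close> (lemma \<open>H_symbol_ge_high\<close>), so up to the factor
  \<open>\<surd>(2/a)\<close> it controls the half derivative on the high frequencies. The low part lies in the
  Sobolev space of order one and the high part in that of order one half, so each satisfies its own
  Gagliardo--Nirenberg inequality.
  Convexity of \<open>t\<^sup>p\<^sup>+\<^sup>1\<close> puts the parts together at the price of \<open>2\<^sup>p\<close>, and the symbol bounds cost at
  most \<open>2\<close> to the power \<open>(p - 1)/2\<close>; the product of the two is the factor in \<open>C_GN\<close>.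

  Turning symbol bounds into norm bounds needs Plancherel's theorem for the \<open>L\<^sup>2\<close> Fourier
  transform: the Parseval identity (\<open>parseval\<close>), and surjectivity (\<open>fourier_transform_surj\<close>),
  without which a multiplier chosen by Hilbert's operator could be meaningless. For
  \<open>f \<in> L\<^sup>1 \<inter> L\<^sup>2\<close> the function \<open>\<bar>\<F> f\<bar>\<^sup>2\<close> is the transform of the autocorrelation of \<open>f\<close>.
  Integrating it against wider and wider Gaussians and moving the transform to the Gaussian
  evaluates the autocorrelation at \<open>0\<close> in the limit, because translation is continuous in \<open>L\<^sup>2\<close>;
  its value there is \<open>\<parallel>f\<parallel>\<^sup>2\<close>. Completeness of \<open>L\<^sup>2\<close> (\<open>L2_complete\<close>) then provides preimages.

  The constants are infima in \<open>[0, \<infinity>]\<close>. An infimum of constants is again a constant as soon as a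
  vanishing right-hand side forces a vanishing left-hand side (\<open>le_Inf_constants\<close>), and this holds
  since a function with vanishing derivative norm vanishes almost everywhere.
\<close>

section \<open>The space of square integrable functions\<close>

lemma borel_measurable_cnj [measurable]: "cnj \<in> borel_measurable borel"
  by (intro borel_measurable_continuous_onI continuous_intros)

lemma in_L2_iff:
  "in_L2 f \<longleftrightarrow> f \<in> borel_measurable borel \<and> integrable lborel (\<lambda>x. (cmod (f x))\<^sup>2)"
  by (auto simp: in_L2_def integrable_iff_bounded)

lemma in_L2_measurable [measurable_dest]: "in_L2 f \<Longrightarrow> f \<in> borel_measurable borel"
  by (simp add: in_L2_iff)

lemma in_L2_integrable_sq: "in_L2 f \<Longrightarrow> integrable lborel (\<lambda>x. (cmod (f x))\<^sup>2)"
  by (simp add: in_L2_iff)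

lemma L2_norm_nonneg [simp]: "L2_norm f \<ge> 0"
  by (simp add: L2_norm_def)

lemma L2_norm_sq: "(L2_norm f)\<^sup>2 = (LINT x|lborel. (cmod (f x))\<^sup>2)"
  by (simp add: L2_norm_def)

lemma nn_integral_cmod_sq:
  "in_L2 f \<Longrightarrow> (\<integral>\<^sup>+x. ennreal ((cmod (f x))\<^sup>2) \<partial>lborel) = ennreal ((L2_norm f)\<^sup>2)"
  by (simp add: in_L2_iff nn_integral_eq_integral L2_norm_sq)

lemma in_L2I_nn_integral:
  assumes "f \<in> borel_measurable borel"
    and "(\<integral>\<^sup>+x. ennreal ((cmod (f x))\<^sup>2) \<partial>lborel) \<le> ennreal B" "B \<ge> 0"
  shows "in_L2 f" "(L2_norm f)\<^sup>2 \<le> B"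
proof -
  show *: "in_L2 f"
    using assms by (auto simp: in_L2_def top_unique less_top[symmetric])
  show "(L2_norm f)\<^sup>2 \<le> B"
    using assms nn_integral_cmod_sq[OF *] by simp
qed

lemma in_L2_dominated:
  assumes "in_L2 g" "f \<in> borel_measurable borel" "\<And>x. cmod (f x) \<le> C * cmod (g x)"
  shows "in_L2 f"
proof -
  have "integrable lborel (\<lambda>x. (cmod (f x))\<^sup>2)"
  proof (rule Bochner_Integration.integrable_bound)
    show "integrable lborel (\<lambda>x. C\<^sup>2 * (cmod (g x))\<^sup>2)"
      using assms(1) by (simp add: in_L2_iff)
    show "AE x in lborel. norm ((cmod (f x))\<^sup>2) \<le> norm (C\<^sup>2 * (cmod (g x))\<^sup>2)"
    proof (intro AE_I2)
      fix x show "norm ((cmod (f x))\<^sup>2) \<le> norm (C\<^sup>2 * (cmod (g x))\<^sup>2)"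
        using power_mono[OF assms(3)[of x], of 2] by (simp add: power_mult_distrib)
    qed
  qed (use assms in measurable)
  then show ?thesis using assms by (simp add: in_L2_iff)
qed

text \<open>The main way to compare norms: on the Fourier side a pointwise bound on symbols is
  all that is available.\<close>

lemma L2_norm_dominated:
  assumes "in_L2 g" "in_L2 f" "C \<ge> 0" "AE x in lborel. cmod (f x) \<le> C * cmod (g x)"
  shows "L2_norm f \<le> C * L2_norm g"
proof -
  have "(L2_norm f)\<^sup>2 \<le> (LINT x|lborel. C\<^sup>2 * (cmod (g x))\<^sup>2)"
    unfolding L2_norm_sq
  proof (rule integral_mono_AE)
    show "AE x in lborel. (cmod (f x))\<^sup>2 \<le> C\<^sup>2 * (cmod (g x))\<^sup>2"
      using assms(4)
    proof eventually_elim
      case (elim x)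
      then show ?case
        using power_mono[OF elim, of 2] by (simp add: power_mult_distrib)
    qed
  qed (use assms in \<open>auto simp: in_L2_iff\<close>)
  also have "\<dots> = (C * L2_norm g)\<^sup>2"
    by (simp add: power_mult_distrib L2_norm_sq)
  finally show ?thesis
    using assms(3) by (meson L2_norm_nonneg mult_nonneg_nonneg power2_le_imp_le)
qed

lemma L2_norm_cong_AE:
  assumes "in_L2 f" "in_L2 g" "AE x in lborel. cmod (f x) = cmod (g x)"
  shows "L2_norm f = L2_norm g"
proof (rule antisym)
  show "L2_norm f \<le> L2_norm g"
    using L2_norm_dominated[OF assms(2,1), of 1] eventually_mono[OF assms(3)] by simp
  show "L2_norm g \<le> L2_norm f"
    using L2_norm_dominated[OF assms(1,2), of 1] eventually_mono[OF assms(3)] by simp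
qed

lemma in_L2_add:
  assumes [measurable]: "in_L2 f" "in_L2 g"
  shows "in_L2 (\<lambda>x. f x + g x)"
proof -
  have "integrable lborel (\<lambda>x. (cmod (f x + g x))\<^sup>2)"
  proof (rule Bochner_Integration.integrable_bound)
    show "integrable lborel (\<lambda>x. 2 * (cmod (f x))\<^sup>2 + 2 * (cmod (g x))\<^sup>2)"
      using assms by (auto simp: in_L2_iff)
    have "(cmod (f x + g x))\<^sup>2 \<le> 2 * (cmod (f x))\<^sup>2 + 2 * (cmod (g x))\<^sup>2" for x
    proof -
      have "(cmod (f x + g x))\<^sup>2 \<le> (cmod (f x) + cmod (g x))\<^sup>2"
        by (simp add: norm_triangle_ineq power_mono)
      also have "\<dots> \<le> 2 * (cmod (f x))\<^sup>2 + 2 * (cmod (g x))\<^sup>2"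
        using sum_squares_bound[of "cmod (f x)" "cmod (g x)"] by (simp add: power2_sum)
      finally show ?thesis .
    qed
    then show "AE x in lborel. norm ((cmod (f x + g x))\<^sup>2)
        \<le> norm (2 * (cmod (f x))\<^sup>2 + 2 * (cmod (g x))\<^sup>2)"
      by (auto intro!: AE_I2)
  qed measurable
  then show ?thesis by (simp add: in_L2_iff)
qed

lemma in_L2_cmult: "in_L2 f \<Longrightarrow> in_L2 (\<lambda>x. a * f x)"
  by (rule in_L2_dominated[of f _ "cmod a"]) (auto simp: norm_mult)

lemma in_L2_diff: "in_L2 f \<Longrightarrow> in_L2 g \<Longrightarrow> in_L2 (\<lambda>x. f x - g x)"
  using in_L2_add[of f "\<lambda>x. -1 * g x"] in_L2_cmult[of g "-1"] by simp

lemma L2_norm_cmult: "L2_norm (\<lambda>x. a * f x) = cmod a * L2_norm f"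
  by (simp add: L2_norm_def norm_mult power_mult_distrib real_sqrt_mult)

lemma L2_norm_minus_commute: "L2_norm (\<lambda>x. f x - g x) = L2_norm (\<lambda>x. g x - f x)"
  by (simp add: L2_norm_def norm_minus_commute)

definition L2_inner :: "(real \<Rightarrow> complex) \<Rightarrow> (real \<Rightarrow> complex) \<Rightarrow> complex" where
  "L2_inner f g = (LINT x|lborel. f x * cnj (g x))"

lemma L2_Cauchy_Schwarz:
  assumes [measurable]: "in_L2 f" "in_L2 g"
  shows "integrable lborel (\<lambda>x. f x * cnj (g x))"
    and "(LINT x|lborel. cmod (f x) * cmod (g x)) \<le> L2_norm f * L2_norm g"
    and "cmod (L2_inner f g) \<le> L2_norm f * L2_norm g"
proof -
  have bound: "a * b \<le> a\<^sup>2 + b\<^sup>2" for a b :: real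
    using sum_squares_bound[of a b] zero_le_power2[of a] zero_le_power2[of b] by linarith
  show int: "integrable lborel (\<lambda>x. f x * cnj (g x))"
  proof (rule Bochner_Integration.integrable_bound)
    show "integrable lborel (\<lambda>x. (cmod (f x))\<^sup>2 + (cmod (g x))\<^sup>2)"
      using assms by (auto simp: in_L2_iff)
  qed (auto simp: norm_mult intro!: AE_I2 bound)
  have int': "integrable lborel (\<lambda>x. cmod (f x) * cmod (g x))"
    using integrable_norm[OF int] by (simp add: norm_mult)
  have "ennreal ((LINT x|lborel. cmod (f x) * cmod (g x))\<^sup>2)
      = (\<integral>\<^sup>+x. ennreal (cmod (f x) * cmod (g x)) \<partial>lborel)\<^sup>2"
    by (simp add: nn_integral_eq_integral int' ennreal_power)
  also have "\<dots> = (\<integral>\<^sup>+x. ennreal (cmod (f x)) * ennreal (cmod (g x)) \<partial>lborel)\<^sup>2"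
    by (simp add: ennreal_mult)
  also have "\<dots> \<le> (\<integral>\<^sup>+x. (ennreal (cmod (f x)))\<^sup>2 \<partial>lborel)
      * (\<integral>\<^sup>+x. (ennreal (cmod (g x)))\<^sup>2 \<partial>lborel)"
    by (rule Cauchy_Schwarz_nn_integral) measurable
  also have "\<dots> = ennreal ((L2_norm f * L2_norm g)\<^sup>2)"
    using assms by (simp add: ennreal_power nn_integral_cmod_sq power_mult_distrib ennreal_mult)
  finally have "(LINT x|lborel. cmod (f x) * cmod (g x))\<^sup>2 \<le> (L2_norm f * L2_norm g)\<^sup>2"
    by simp
  then show *: "(LINT x|lborel. cmod (f x) * cmod (g x)) \<le> L2_norm f * L2_norm g"
    by (rule power2_le_imp_le) simp
  have "cmod (L2_inner f g) \<le> (LINT x|lborel. cmod (f x) * cmod (g x))"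
    unfolding L2_inner_def using integral_norm_bound[of lborel "\<lambda>x. f x * cnj (g x)"]
    by (simp add: norm_mult)
  with * show "cmod (L2_inner f g) \<le> L2_norm f * L2_norm g" by linarith
qed

lemma L2_inner_self: "L2_inner f f = complex_of_real ((L2_norm f)\<^sup>2)"
  by (simp add: L2_inner_def L2_norm_sq complex_norm_square[symmetric] del: of_real_power)

lemma L2_inner_diff_left:
  assumes "in_L2 f" "in_L2 g" "in_L2 h"
  shows "L2_inner (\<lambda>x. f x - g x) h = L2_inner f h - L2_inner g h"
  using assms by (simp add: L2_inner_def left_diff_distrib L2_Cauchy_Schwarz)

lemma L2_norm_add_sq:
  assumes "in_L2 f" "in_L2 g"
  shows "(L2_norm (\<lambda>x. f x + g x))\<^sup>2 = (L2_norm f)\<^sup>2 + 2 * Re (L2_inner f g) + (L2_norm g)\<^sup>2"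
proof -
  have "(cmod (f x + g x))\<^sup>2 = (cmod (f x))\<^sup>2 + 2 * Re (f x * cnj (g x)) + (cmod (g x))\<^sup>2" for x
    unfolding cmod_power2 by (simp add: power2_sum algebra_simps)
  then have "(L2_norm (\<lambda>x. f x + g x))\<^sup>2
      = (LINT x|lborel. (cmod (f x))\<^sup>2 + 2 * Re (f x * cnj (g x)) + (cmod (g x))\<^sup>2)"
    unfolding L2_norm_sq by (intro Bochner_Integration.integral_cong) auto
  then show ?thesis
    using assms L2_Cauchy_Schwarz(1)[OF assms]
    by (simp add: L2_norm_sq L2_inner_def in_L2_iff integral_Re[symmetric] del: integral_Re times_complex.sel)
qed

lemma L2_norm_diff_sq:
  assumes "in_L2 f" "in_L2 g"
  shows "(L2_norm (\<lambda>x. f x - g x))\<^sup>2 = (L2_norm f)\<^sup>2 - 2 * Re (L2_inner f g) + (L2_norm g)\<^sup>2"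
  using L2_norm_add_sq[OF assms(1) in_L2_cmult[OF assms(2), of "-1"]]
    L2_norm_cmult[of "-1" g] by (simp add: L2_inner_def)

lemma L2_norm_triangle:
  assumes "in_L2 f" "in_L2 g"
  shows "L2_norm (\<lambda>x. f x + g x) \<le> L2_norm f + L2_norm g"
proof (rule power2_le_imp_le)
  show "(L2_norm (\<lambda>x. f x + g x))\<^sup>2 \<le> (L2_norm f + L2_norm g)\<^sup>2"
    unfolding L2_norm_add_sq[OF assms] power2_sum
    using L2_Cauchy_Schwarz(3)[OF assms] complex_Re_le_cmod[of "L2_inner f g"] by linarith
qed simp

lemma L2_norm_diff_le:
  assumes "in_L2 f" "in_L2 g"
  shows "L2_norm (\<lambda>x. f x - g x) \<le> L2_norm f + L2_norm g"
  using L2_norm_triangle[OF assms(1) in_L2_cmult[OF assms(2), of "-1"]] L2_norm_cmult[of "-1" g] by simp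

lemma L2_norm_triangle_diff:
  assumes "in_L2 f" "in_L2 g" "in_L2 h"
  shows "L2_norm (\<lambda>x. f x - h x) \<le> L2_norm (\<lambda>x. f x - g x) + L2_norm (\<lambda>x. g x - h x)"
  using L2_norm_triangle[of "\<lambda>x. f x - g x" "\<lambda>x. g x - h x"] assms by (simp add: in_L2_diff)

lemma L2_norm_diff_ge:
  assumes "in_L2 f" "in_L2 g"
  shows "\<bar>L2_norm f - L2_norm g\<bar> \<le> L2_norm (\<lambda>x. f x - g x)"
  using L2_norm_triangle[of "\<lambda>x. f x - g x" g] L2_norm_triangle[of "\<lambda>x. g x - f x" f]
    L2_norm_minus_commute[of f g] assms by (simp add: in_L2_diff abs_le_iff)

lemma L2_norm_tendsto:
  assumes "\<And>n. in_L2 (f n)" "in_L2 g" "((\<lambda>n. L2_norm (\<lambda>x. f n x - g x)) \<longlongrightarrow> 0) F"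
  shows "((\<lambda>n. L2_norm (f n)) \<longlongrightarrow> L2_norm g) F"
proof (rule LIM_zero_cancel, rule Lim_null_comparison[OF _ assms(3)])
  show "\<forall>\<^sub>F n in F. norm (L2_norm (f n) - L2_norm g) \<le> L2_norm (\<lambda>x. f n x - g x)"
    using L2_norm_diff_ge assms by simp
qed

lemma L2_inner_tendsto_right:
  assumes "\<And>n. in_L2 (f n)" "in_L2 g" "in_L2 h" "((\<lambda>n. L2_norm (\<lambda>x. f n x - g x)) \<longlongrightarrow> 0) F"
  shows "((\<lambda>n. L2_inner h (f n)) \<longlongrightarrow> L2_inner h g) F"
proof (rule LIM_zero_cancel, rule Lim_null_comparison)
  show "((\<lambda>n. L2_norm h * L2_norm (\<lambda>x. f n x - g x)) \<longlongrightarrow> 0) F"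
    using tendsto_mult_right_zero[OF assms(4)] .
  show "\<forall>\<^sub>F n in F. norm (L2_inner h (f n) - L2_inner h g) \<le> L2_norm h * L2_norm (\<lambda>x. f n x - g x)"
  proof (intro always_eventually allI)
    fix n
    have "L2_inner h (f n) - L2_inner h g = L2_inner h (\<lambda>x. f n x - g x)"
      using assms by (simp add: L2_inner_def right_diff_distrib L2_Cauchy_Schwarz)
    then show "norm (L2_inner h (f n) - L2_inner h g) \<le> L2_norm h * L2_norm (\<lambda>x. f n x - g x)"
      using assms L2_Cauchy_Schwarz(3)[of h "\<lambda>x. f n x - g x"] by (simp add: in_L2_diff)
  qed
qed

lemma L2_norm_eq_0_iff_AE:
  assumes "in_L2 f" shows "L2_norm f = 0 \<longleftrightarrow> (AE x in lborel. f x = 0)"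
  using assms integral_nonneg_eq_0_iff_AE[of lborel "\<lambda>x. (cmod (f x))\<^sup>2"]
  by (simp add: L2_norm_def in_L2_iff)

text \<open>Limits in the mean are unique along any proper filter; below the filter is the radius of
  truncation tending to infinity.\<close>

lemma AE_eq_if_L2_limits:
  assumes "\<And>n. in_L2 (f n)" "in_L2 g" "in_L2 h" "F \<noteq> bot"
    "((\<lambda>n. L2_norm (\<lambda>x. g x - f n x)) \<longlongrightarrow> 0) F" "((\<lambda>n. L2_norm (\<lambda>x. h x - f n x)) \<longlongrightarrow> 0) F"
  shows "AE x in lborel. g x = h x"
proof -
  have "L2_norm (\<lambda>x. g x - h x) \<le> 0"
  proof (rule tendsto_lowerbound)
    show "((\<lambda>n. L2_norm (\<lambda>x. g x - f n x) + L2_norm (\<lambda>x. h x - f n x)) \<longlongrightarrow> 0) F"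
      using tendsto_add[OF assms(5,6)] by simp
    show "\<forall>\<^sub>F n in F. L2_norm (\<lambda>x. g x - h x)
        \<le> L2_norm (\<lambda>x. g x - f n x) + L2_norm (\<lambda>x. h x - f n x)"
      using L2_norm_triangle_diff[of g _ h] L2_norm_minus_commute[of h] assms by simp
  qed fact
  then have "L2_norm (\<lambda>x. g x - h x) = 0" by (simp add: order_antisym)
  then show ?thesis
    using L2_norm_eq_0_iff_AE[of "\<lambda>x. g x - h x"] assms by (simp add: in_L2_diff)
qed

text \<open>Truncation makes a square integrable function integrable, so that its Fourier integral
  exists pointwise.\<close>

definition truncate :: "real \<Rightarrow> (real \<Rightarrow> complex) \<Rightarrow> real \<Rightarrow> complex" where
  "truncate R f = (\<lambda>x. indicator {-R..R} x *\<^sub>R f x)"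

lemma in_L2_truncate: "in_L2 f \<Longrightarrow> in_L2 (truncate R f)"
  by (rule in_L2_dominated[of f _ 1]) (auto simp: truncate_def indicator_def)

lemma integrable_truncate:
  assumes [measurable]: "in_L2 f"
  shows "integrable lborel (truncate R f)"
proof (rule Bochner_Integration.integrable_bound)
  show "integrable lborel (\<lambda>x. indicator {-R..R} x + (cmod (f x))\<^sup>2)"
    using assms by (intro Bochner_Integration.integrable_add integrable_real_indicator)
      (auto simp: in_L2_iff emeasure_lborel_Icc_eq)
  have "t \<le> 1 + t\<^sup>2" for t :: real
  proof -
    have "2 * t \<le> t\<^sup>2 + 1" using sum_squares_bound[of t 1] by simp
    then show ?thesis using zero_le_power2[of t] by linarith
  qed
  then show "AE x in lborel. norm (truncate R f x) \<le> norm (indicator {-R..R} x + (cmod (f x))\<^sup>2)"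
    by (auto simp: truncate_def indicator_def abs_of_nonneg intro!: AE_I2)
qed (simp add: truncate_def)

lemma L2_norm_truncate_tendsto:
  assumes [measurable]: "in_L2 f"
  shows "((\<lambda>R. L2_norm (\<lambda>x. truncate R f x - f x)) \<longlongrightarrow> 0) at_top"
proof -
  have "((\<lambda>R. LINT x|lborel. (cmod (truncate R f x - f x))\<^sup>2) \<longlongrightarrow> (LINT x|(lborel::real measure). 0)) at_top"
  proof (rule integral_dominated_convergence_at_top)
    show "integrable lborel (\<lambda>x. (cmod (f x))\<^sup>2)" using assms by (simp add: in_L2_iff)
    show "AE x in lborel. ((\<lambda>R. (cmod (truncate R f x - f x))\<^sup>2) \<longlongrightarrow> 0) at_top"
    proof (intro AE_I2 tendsto_eventually)
      fix x
      show "\<forall>\<^sub>F R in at_top. (cmod (truncate R f x - f x))\<^sup>2 = 0"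
        using eventually_ge_at_top[of "\<bar>x\<bar>"]
        by eventually_elim (auto simp: truncate_def indicator_def)
    qed
    show "\<forall>\<^sub>F R in at_top. AE x in lborel. norm ((cmod (truncate R f x - f x))\<^sup>2) \<le> (cmod (f x))\<^sup>2"
      by (auto simp: truncate_def indicator_def)
  qed (simp_all add: truncate_def)
  from tendsto_real_sqrt[OF this] show ?thesis
    by (simp add: L2_norm_def)
qed

section \<open>Continuity of translation in the mean\<close>

lemma L2_norm_tendsto_dominated:
  assumes [measurable]: "\<And>k. f k \<in> borel_measurable borel" "g \<in> borel_measurable borel"
    and "integrable lborel w"
    and "AE x in lborel. (\<lambda>k. f k x) \<longlonglongrightarrow> g x"
    and "\<And>k::nat. AE x in lborel. (cmod (f k x - g x))\<^sup>2 \<le> w x"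
  shows "(\<lambda>k. L2_norm (\<lambda>x. f k x - g x)) \<longlonglongrightarrow> 0"
proof -
  have "(\<lambda>k. LINT x|lborel. (cmod (f k x - g x))\<^sup>2) \<longlonglongrightarrow> (LINT x|(lborel::real measure). 0)"
  proof (rule integral_dominated_convergence)
    show "AE x in lborel. (\<lambda>k. (cmod (f k x - g x))\<^sup>2) \<longlonglongrightarrow> 0"
      using assms(4)
    proof eventually_elim
      case (elim x)
      then have "(\<lambda>k. cmod (f k x - g x)) \<longlonglongrightarrow> 0" by (simp add: LIM_zero tendsto_norm_zero)
      from tendsto_power[OF this, of 2] show ?case by simp
    qed
    show "AE x in lborel. norm ((cmod (f k x - g x))\<^sup>2) \<le> w x" for k
      using assms(5)[of k] by simp
  qed (use assms(3) in \<open>simp_all\<close>)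
  from tendsto_real_sqrt[OF this] show ?thesis by (simp add: L2_norm_def)
qed

lemma in_L2_bounded_support:
  assumes "f \<in> borel_measurable borel" "\<And>x. cmod (f x) \<le> B" "\<And>x. \<bar>x\<bar> > N \<Longrightarrow> f x = 0"
  shows "in_L2 f"
proof -
  have "in_L2 (indicator {-N..N})"
  proof -
    have "(\<lambda>x. (cmod (indicator {-N..N} x))\<^sup>2) = indicat_real {-N..N}"
      by (auto simp: indicator_def fun_eq_iff)
    then show ?thesis
      by (auto simp: in_L2_iff emeasure_lborel_Icc_eq intro!: integrable_real_indicator)
  qed
  then show ?thesis
  proof (rule in_L2_dominated)
    fix x show "cmod (f x) \<le> \<bar>B\<bar> * cmod (indicator {-N..N} x)"
      using assms(2,3)[of x] by (cases "\<bar>x\<bar> > N") (auto simp: indicator_def abs_if split: if_splits)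
  qed fact
qed

lemma L2_dense_bounded_support:
  assumes [measurable]: "in_L2 f" and "e > 0"
  obtains h n where "n > 0" "h \<in> borel_measurable borel" "\<And>x. cmod (h x) \<le> n"
    "\<And>x. \<bar>x\<bar> > n \<Longrightarrow> h x = 0" "L2_norm (\<lambda>x. h x - f x) < e"
proof -
  define h where "h n x = (if \<bar>x\<bar> \<le> real n \<and> cmod (f x) \<le> real n then f x else 0)" for n x
  have [measurable]: "h n \<in> borel_measurable borel" for n unfolding h_def by measurable
  have "(\<lambda>n. L2_norm (\<lambda>x. h n x - f x)) \<longlonglongrightarrow> 0"
  proof (rule L2_norm_tendsto_dominated)
    show "integrable lborel (\<lambda>x. (cmod (f x))\<^sup>2)" using assms by (simp add: in_L2_iff)
    show "AE x in lborel. (cmod (h k x - f x))\<^sup>2 \<le> (cmod (f x))\<^sup>2" for k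
      by (auto simp: h_def)
    show "AE x in lborel. (\<lambda>k. h k x) \<longlonglongrightarrow> f x"
    proof (intro AE_I2 tendsto_eventually)
      fix x
      obtain K :: nat where K: "\<bar>x\<bar> + cmod (f x) \<le> real K" using real_arch_simple by blast
      show "\<forall>\<^sub>F k in sequentially. h k x = f x"
        using eventually_ge_at_top[of K]
      proof eventually_elim
        case (elim k)
        then have "\<bar>x\<bar> + cmod (f x) \<le> real k" using K by linarith
        then show ?case
          using norm_ge_zero[of "f x"] abs_ge_zero[of x] by (subst h_def, subst if_P) (linarith | simp)+
      qed
    qed
  qed auto
  then have "\<forall>\<^sub>F n in sequentially. L2_norm (\<lambda>x. h n x - f x) < e"
    using \<open>e > 0\<close> by (simp add: order_tendsto_iff)
  then have "\<forall>\<^sub>F n in sequentially. L2_norm (\<lambda>x. h n x - f x) < e \<and> n > 0"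
    using eventually_gt_at_top[of 0] by eventually_elim auto
  then obtain n where "L2_norm (\<lambda>x. h n x - f x) < e" "n > 0"
    using eventually_happens'[OF sequentially_bot] by blast
  then show ?thesis by (intro that[of "real n" "h n"]) (auto simp: h_def)
qed

text \<open>After a reduction to a bounded function \<open>h\<close> with bounded support, Lusin-type
  approximation gives continuous functions converging to \<open>h\<close> almost everywhere, without any bound.
  A radial clamp at height \<open>n\<close> and a trapezoidal cut-off keep them continuous, leave the limit
  unchanged and make dominated convergence applicable.\<close>

lemma L2_dense_continuous_support:
  assumes f: "in_L2 f" and "e > 0"
  obtains g B N where "continuous_on UNIV g" "\<And>x. cmod (g x) \<le> B" "\<And>x. \<bar>x\<bar> > N \<Longrightarrow> g x = 0"
    "L2_norm (\<lambda>x. g x - f x) < e"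
proof -
  obtain h n where h: "n > 0" and [measurable]: "h \<in> borel_measurable borel"
    and hn: "\<And>x. cmod (h x) \<le> n" and h0: "\<And>x. \<bar>x\<bar> > n \<Longrightarrow> h x = 0"
    and hf: "L2_norm (\<lambda>x. h x - f x) < e/2"
    using L2_dense_bounded_support[OF f half_gt_zero[OF \<open>e > 0\<close>]] by metis
  have "h \<in> borel_measurable lebesgue"
    using measurable_completion[of h lborel borel] by simp
  then have "h measurable_on UNIV"
    by (rule lebesgue_measurable_imp_measurable_on) auto
  then obtain M G where M: "negligible M" and contG: "\<And>k::nat. continuous_on UNIV (G k)"
    and lim: "\<And>x. x \<notin> M \<Longrightarrow> (\<lambda>k. G k x) \<longlonglongrightarrow> h x"
    unfolding measurable_on_def by auto
  have "AE x in lebesgue. x \<notin> M"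
    using M negligible_iff_null_sets AE_not_in by blast
  then have AE_M: "AE x in lborel. x \<notin> M" by (simp add: AE_completion_iff)
  define g where "g k x = (max 0 (min 1 (n + 1 - \<bar>x\<bar>)) * (n / max n (cmod (G k x)))) *\<^sub>R G k x" for k x
  have contg: "continuous_on UNIV (g k)" for k
    unfolding g_def using h by (intro continuous_intros contG) (auto simp: max_def)
  then have [measurable]: "g k \<in> borel_measurable borel" for k
    by (rule borel_measurable_continuous_onI)
  have clamp: "n / max n (cmod z) * cmod z \<le> n" for z
    using h by (auto simp: max_def field_simps)
  have gn: "cmod (g k x) \<le> n" for k x
  proof -
    have "cmod (g k x) = max 0 (min 1 (n + 1 - \<bar>x\<bar>)) * (n / max n (cmod (G k x)) * cmod (G k x))"
      unfolding g_def using h by (simp add: abs_mult)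
    also have "\<dots> \<le> 1 * n"
      using h by (intro mult_mono clamp) auto
    finally show ?thesis by simp
  qed
  have g0: "g k x = 0" if "\<bar>x\<bar> > n + 1" for k x
    using that by (auto simp: g_def)
  have g_L2: "in_L2 (g k)" and h_L2: "in_L2 h" for k
    using in_L2_bounded_support[of "g k" n "n+1"] gn g0 in_L2_bounded_support[of h n n] hn h0 by auto
  have "(\<lambda>k. L2_norm (\<lambda>x. g k x - h x)) \<longlonglongrightarrow> 0"
  proof (rule L2_norm_tendsto_dominated)
    show "integrable lborel (\<lambda>x. (2 * n)\<^sup>2 * indicator {-(n+1)..n+1} x)"
      by (intro integrable_mult_right integrable_real_indicator) (auto simp: emeasure_lborel_Icc_eq)
    show "AE x in lborel. (cmod (g k x - h x))\<^sup>2 \<le> (2 * n)\<^sup>2 * indicator {-(n+1)..n+1} x" for k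
    proof (intro AE_I2)
      fix x
      have "cmod (g k x - h x) \<le> 2 * n"
        using norm_triangle_ineq4[of "g k x" "h x"] gn[of k x] hn[of x] by linarith
      then have "(cmod (g k x - h x))\<^sup>2 \<le> (2 * n)\<^sup>2" by (intro power_mono) auto
      then show "(cmod (g k x - h x))\<^sup>2 \<le> (2 * n)\<^sup>2 * indicator {-(n+1)..n+1} x"
        using g0[of x k] h0[of x] by (cases "\<bar>x\<bar> > n + 1") (auto simp: indicator_def)
    qed
    show "AE x in lborel. (\<lambda>k. g k x) \<longlonglongrightarrow> h x"
      using AE_M
    proof eventually_elim
      case (elim x)
      have "(\<lambda>k. g k x) \<longlonglongrightarrow> (max 0 (min 1 (n + 1 - \<bar>x\<bar>)) * (n / max n (cmod (h x)))) *\<^sub>R h x"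
        unfolding g_def using h by (intro tendsto_intros lim elim) auto
      also have "(max 0 (min 1 (n + 1 - \<bar>x\<bar>)) * (n / max n (cmod (h x)))) *\<^sub>R h x = h x"
        using h hn[of x] h0[of x] by (cases "\<bar>x\<bar> > n") (auto simp: max_def min_def)
      finally show ?case .
    qed
  qed auto
  then have "\<forall>\<^sub>F k in sequentially. L2_norm (\<lambda>x. g k x - h x) < e/2"
    by (rule order_tendstoD(2)) (use \<open>e > 0\<close> in simp)
  then obtain k where "L2_norm (\<lambda>x. g k x - h x) < e/2"
    using eventually_happens'[OF sequentially_bot] by blast
  then have "L2_norm (\<lambda>x. g k x - f x) < e"
    using L2_norm_triangle_diff[OF g_L2 h_L2 f, of k] hf by linarith
  then show ?thesis using that[of "g k" n "n+1"] contg gn g0 by auto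
qed

lemma
  assumes [measurable]: "in_L2 f"
  shows in_L2_shift: "in_L2 (\<lambda>x. f (x + t))" and L2_norm_shift: "L2_norm (\<lambda>x. f (x + t)) = L2_norm f"
proof -
  have [measurable]: "f \<in> borel_measurable borel" using assms by (simp add: in_L2_iff)
  have "(\<lambda>x. f (x + t)) \<in> borel_measurable borel" by measurable
  then show "in_L2 (\<lambda>x. f (x + t))"
    unfolding in_L2_iff using lborel_integrable_real_affine[OF in_L2_integrable_sq[OF assms], of 1 t]
    by (simp add: add.commute)
  show "L2_norm (\<lambda>x. f (x + t)) = L2_norm f"
    unfolding L2_norm_def using lborel_integral_real_affine[of 1 "\<lambda>x. (cmod (f x))\<^sup>2" t]
    by (simp add: add.commute)
qed

text \<open>For continuous functions with bounded support this is dominated convergence. Translations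
  are isometries, so the error of approximating \<open>f\<close> by such a function is the same before and after
  the shift.\<close>

lemma L2_norm_shift_tendsto:
  assumes f: "in_L2 f" and s: "s \<longlonglongrightarrow> 0"
  shows "(\<lambda>k. L2_norm (\<lambda>x. f (x + s k) - f x)) \<longlonglongrightarrow> 0"
proof (rule tendstoI)
  fix e :: real assume "e > 0"
  obtain g B N where cont: "continuous_on UNIV g" and B: "\<And>x. cmod (g x) \<le> B"
    and N: "\<And>x. \<bar>x\<bar> > N \<Longrightarrow> g x = 0" and gf: "L2_norm (\<lambda>x. g x - f x) < e/3"
    using L2_dense_continuous_support[OF f, of "e/3"] \<open>e > 0\<close>
    by (metis divide_pos_pos zero_less_numeral)
  have [measurable]: "g \<in> borel_measurable borel"
    using cont by (rule borel_measurable_continuous_onI)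
  have g: "in_L2 g" using B N by (rule in_L2_bounded_support[rotated]) measurable
  \<comment> \<open>Bounded shifts keep all supports inside one interval, which gives the integrable majorant.\<close>
  have "Bseq s" using s convergentI convergent_imp_Bseq by blast
  then obtain S where S: "\<And>k. \<bar>s k\<bar> \<le> S" by (auto simp: Bseq_def)
  have "(\<lambda>k. L2_norm (\<lambda>x. g (x + s k) - g x)) \<longlonglongrightarrow> 0"
  proof (rule L2_norm_tendsto_dominated)
    show "integrable lborel (\<lambda>x. (2 * B)\<^sup>2 * indicator {-(N+S)..N+S} x)"
      by (intro integrable_mult_right integrable_real_indicator) (auto simp: emeasure_lborel_Icc_eq)
    show "AE x in lborel. (cmod (g (x + s k) - g x))\<^sup>2 \<le> (2 * B)\<^sup>2 * indicator {-(N+S)..N+S} x" for k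
    proof (intro AE_I2)
      fix x
      have "cmod (g (x + s k) - g x) \<le> 2 * B"
        using norm_triangle_ineq4[of "g (x + s k)" "g x"] B[of "x + s k"] B[of x] by linarith
      then have *: "(cmod (g (x + s k) - g x))\<^sup>2 \<le> (2 * B)\<^sup>2" by (intro power_mono) auto
      show "(cmod (g (x + s k) - g x))\<^sup>2 \<le> (2 * B)\<^sup>2 * indicator {-(N+S)..N+S} x"
      proof (cases "\<bar>x\<bar> > N + S")
        case True
        then have "g (x + s k) = 0" "g x = 0" using S[of k] by (auto intro!: N)
        then show ?thesis by simp
      next
        case False
        then have "x \<in> {-(N+S)..N+S}" by auto
        then show ?thesis using * by simp
      qed
    qed
    show "AE x in lborel. (\<lambda>k. g (x + s k)) \<longlonglongrightarrow> g x"
    proof (intro AE_I2)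
      fix x
      have "(\<lambda>k. x + s k) \<longlonglongrightarrow> x" using tendsto_add[OF tendsto_const s, of x] by simp
      then show "(\<lambda>k. g (x + s k)) \<longlonglongrightarrow> g x"
        using cont continuous_on_tendsto_compose[of UNIV g] by fastforce
    qed
  qed auto
  then have "\<forall>\<^sub>F k in sequentially. L2_norm (\<lambda>x. g (x + s k) - g x) < e/3"
    by (rule order_tendstoD(2)) (use \<open>e > 0\<close> in simp)
  then show "\<forall>\<^sub>F k in sequentially. dist (L2_norm (\<lambda>x. f (x + s k) - f x)) 0 < e"
  proof eventually_elim
    case (elim k)
    have "L2_norm (\<lambda>x. f (x + s k) - g (x + s k)) < e/3"
      using L2_norm_shift[OF in_L2_diff[OF g f], of "s k"] gf
      by (subst L2_norm_minus_commute) simp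
    moreover have "L2_norm (\<lambda>x. f (x + s k) - f x) \<le> L2_norm (\<lambda>x. f (x + s k) - g (x + s k))
        + L2_norm (\<lambda>x. g (x + s k) - f x)"
      by (intro L2_norm_triangle_diff in_L2_shift f g)
    moreover have "L2_norm (\<lambda>x. g (x + s k) - f x) \<le> L2_norm (\<lambda>x. g (x + s k) - g x)
        + L2_norm (\<lambda>x. g x - f x)"
      by (intro L2_norm_triangle_diff in_L2_shift f g)
    ultimately show ?case using elim gf by simp
  qed
qed

section \<open>Plancherel on integrable square integrable functions\<close>

definition ft :: "(real \<Rightarrow> complex) \<Rightarrow> real \<Rightarrow> complex" where
  "ft f \<xi> = (LINT x|lborel. cis (- (x * \<xi>)) * f x)"

lemma borel_measurable_cis [measurable]: "cis \<in> borel_measurable borel"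
  by (intro borel_measurable_continuous_onI continuous_intros)

lemma ft_measurable [measurable]:
  assumes [measurable]: "f \<in> borel_measurable borel"
  shows "ft f \<in> borel_measurable borel"
  unfolding ft_def[abs_def] by measurable

lemma integrable_cis_mult:
  assumes "integrable lborel f" "k \<in> borel_measurable borel"
  shows "integrable lborel (\<lambda>x::real. cis (k x) * f x)"
  by (rule Bochner_Integration.integrable_bound[OF assms(1)])
    (use assms borel_measurable_integrable[OF assms(1)] in \<open>auto simp: norm_mult\<close>)

lemma ft_diff:
  assumes "integrable lborel f" "integrable lborel g"
  shows "ft (\<lambda>x. f x - g x) \<xi> = ft f \<xi> - ft g \<xi>"
  unfolding ft_def right_diff_distrib
  by (intro Bochner_Integration.integral_diff integrable_cis_mult assms) measurable

text \<open>The integrability needed for Fubini in the multiplication formula.\<close>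

lemma integrable_kernel_product:
  fixes f g :: "real \<Rightarrow> complex"
  assumes f: "integrable lborel f" and g: "integrable lborel g"
    and [measurable]: "case_prod K \<in> borel_measurable (lborel \<Otimes>\<^sub>M lborel)"
    and K: "\<And>x y. cmod (K x y) = 1"
  shows "integrable (lborel \<Otimes>\<^sub>M lborel) (\<lambda>(x, y). K x y * (f x * g y))"
proof (rule lborel_pair.Fubini_integrable)
  note [measurable] = borel_measurable_integrable[OF f] borel_measurable_integrable[OF g]
  show "(\<lambda>(x, y). K x y * (f x * g y)) \<in> borel_measurable (lborel \<Otimes>\<^sub>M lborel)"
    by measurable
  have "integrable lborel (\<lambda>x. cmod (f x) * (LINT y|lborel. cmod (g y)))"
    using f by auto
  then show "integrable lborel (\<lambda>x. LINT y|lborel. norm (case (x, y) of (x, y) \<Rightarrow> K x y * (f x * g y)))"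
    by (simp add: norm_mult K)
  show "AE x in lborel. integrable lborel (\<lambda>y. case (x, y) of (x, y) \<Rightarrow> K x y * (f x * g y))"
  proof (intro AE_I2)
    fix x :: real
    have "integrable lborel (\<lambda>y. f x * g y)" using g by auto
    then show "integrable lborel (\<lambda>y. case (x, y) of (x, y) \<Rightarrow> K x y * (f x * g y))"
      by (rule Bochner_Integration.integrable_bound) (auto simp: norm_mult K)
  qed
qed

text \<open>Both sides are the double integral of \<open>exp (- \<i> x y) f(x) g(y)\<close>. This identity carries the
  Gaussian regularisation as well as the proof of surjectivity.\<close>

lemma ft_multiplication_formula:
  assumes f: "integrable lborel f" and g: "integrable lborel g"
  shows "(LINT x|lborel. ft f x * g x) = (LINT x|lborel. f x * ft g x)"
proof -
  have int: "integrable (lborel \<Otimes>\<^sub>M lborel) (\<lambda>(x, y). cis (- (x * y)) * (f x * g y))"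
    by (intro integrable_kernel_product f g) auto
  have "(LINT y|lborel. ft f y * g y) = (LINT y|lborel. LINT x|lborel. cis (- (x * y)) * (f x * g y))"
    by (simp add: ft_def mult.assoc flip: integral_mult_left_zero)
  also have "\<dots> = (LINT x|lborel. LINT y|lborel. cis (- (x * y)) * (f x * g y))"
    using int by (rule lborel_pair.Fubini_integral)
  also have "\<dots> = (LINT x|lborel. f x * ft g x)"
    by (simp add: ft_def mult_ac flip: integral_mult_right_zero)
  finally show ?thesis .
qed

definition autocorrelation :: "(real \<Rightarrow> complex) \<Rightarrow> real \<Rightarrow> complex" where
  "autocorrelation f t = (LINT y|lborel. f (y + t) * cnj (f y))"

text \<open>The autocorrelation is the convolution of \<open>f\<close> with its conjugate reflection, whose transforms
  are conjugate to each other; hence its transform is nonnegative.\<close>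

lemma
  assumes f: "integrable lborel f"
  shows integrable_autocorrelation: "integrable lborel (autocorrelation f)"
    and ft_autocorrelation: "ft (autocorrelation f) \<xi> = complex_of_real ((cmod (ft f \<xi>))\<^sup>2)"
proof -
  note [measurable] = borel_measurable_integrable[OF f]
  have shift: "integrable lborel (\<lambda>t. f (y + t))" for y
    using lborel_integrable_real_affine[OF f, of 1 y] by simp
  have shift_norm: "(LINT t|lborel. cmod (f (y + t))) = (LINT t|lborel. cmod (f t))" for y
    using lborel_integral_real_affine[of 1 "\<lambda>t. cmod (f t)" y] by simp
  have int: "integrable (lborel \<Otimes>\<^sub>M lborel) (\<lambda>(y, t). cis (- (t * \<eta>)) * (f (y + t) * cnj (f y)))" for \<eta>
  proof (rule lborel_pair.Fubini_integrable)
    have "integrable lborel (\<lambda>y. (LINT t|lborel. cmod (f t)) * cmod (f y))"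
      using f by auto
    then show "integrable lborel (\<lambda>y. LINT t|lborel.
        norm (case (y, t) of (y, t) \<Rightarrow> cis (- (t * \<eta>)) * (f (y + t) * cnj (f y))))"
      by (simp add: norm_mult shift_norm)
    show "AE y in lborel. integrable lborel
        (\<lambda>t. case (y, t) of (y, t) \<Rightarrow> cis (- (t * \<eta>)) * (f (y + t) * cnj (f y)))"
      using shift by (auto intro!: integrable_cis_mult)
  qed measurable
  show "integrable lborel (autocorrelation f)"
    using lborel_pair.integrable_snd[OF int[of 0]] by (simp add: autocorrelation_def[abs_def])
  have shifted: "(LINT t|lborel. cis (- (t * \<xi>)) * f (y + t)) = cis (y * \<xi>) * ft f \<xi>" for y
  proof -
    have "ft f \<xi> = (LINT t|lborel. cis (- ((y + t) * \<xi>)) * f (y + t))"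
      unfolding ft_def using lborel_integral_real_affine[of 1 "\<lambda>x. cis (- (x * \<xi>)) * f x" y] by simp
    then have "cis (y * \<xi>) * ft f \<xi> = (LINT t|lborel. cis (y * \<xi>) * (cis (- ((y + t) * \<xi>)) * f (y + t)))"
      by simp
    also have "\<dots> = (LINT t|lborel. cis (- (t * \<xi>)) * f (y + t))"
      by (simp add: mult.assoc[symmetric] cis_mult algebra_simps)
    finally show ?thesis by simp
  qed
  have "ft (autocorrelation f) \<xi> = (LINT t|lborel. LINT y|lborel. cis (- (t * \<xi>)) * (f (y + t) * cnj (f y)))"
    by (simp add: ft_def autocorrelation_def flip: integral_mult_right_zero)
  also have "\<dots> = (LINT y|lborel. LINT t|lborel. cis (- (t * \<xi>)) * (f (y + t) * cnj (f y)))"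
    using int by (rule lborel_pair.Fubini_integral)
  also have "\<dots> = (LINT y|lborel. (LINT t|lborel. cis (- (t * \<xi>)) * f (y + t)) * cnj (f y))"
    by (simp add: mult.assoc flip: integral_mult_left_zero)
  also have "\<dots> = (LINT y|lborel. ft f \<xi> * cnj (cis (- (y * \<xi>)) * f y))"
    unfolding shifted by (intro Bochner_Integration.integral_cong) (auto simp: cis_cnj)
  also have "\<dots> = ft f \<xi> * cnj (ft f \<xi>)"
    by (simp only: integral_mult_right_zero Bochner_Integration.integral_cnj ft_def)
  finally show "ft (autocorrelation f) \<xi> = complex_of_real ((cmod (ft f \<xi>))\<^sup>2)"
    by (simp add: complex_norm_square del: of_real_power)
qed

lemma integrable_gaussian: "integrable lborel (\<lambda>x::real. exp (- x\<^sup>2 / 2))"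
proof -
  have "integrable lborel (\<lambda>x. sqrt (2 * pi) * std_normal_density x)"
    by (intro integrable_mult_right integrable_normal_density) simp
  then show ?thesis by (simp add: std_normal_density_def)
qed

lemma integral_gaussian: "(LINT x|lborel. exp (- x\<^sup>2 / 2)) = sqrt (2 * pi)"
proof -
  have "(LINT x|lborel. sqrt (2 * pi) * std_normal_density x) = sqrt (2 * pi)"
    by (simp add: integral_normal_density)
  then show ?thesis by (simp add: std_normal_density_def)
qed

text \<open>The characteristic function of the standard normal distribution, without the normalisation.\<close>

lemma ft_gaussian:
  "ft (\<lambda>x. complex_of_real (exp (- x\<^sup>2 / 2))) \<xi> = complex_of_real (sqrt (2 * pi) * exp (- \<xi>\<^sup>2 / 2))"
proof -
  have "complex_of_real (exp (- \<xi>\<^sup>2 / 2)) = char std_normal_distribution (-\<xi>)"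
    by (simp add: char_std_normal_distribution)
  also have "\<dots> = (LINT x|lborel. std_normal_density x *\<^sub>R iexp (-\<xi> * x))"
    unfolding char_def by (subst integral_density) auto
  also have "\<dots> = (LINT x|lborel. (1 / complex_of_real (sqrt (2 * pi)))
      * (cis (- (x * \<xi>)) * complex_of_real (exp (- x\<^sup>2 / 2))))"
    by (intro Bochner_Integration.integral_cong)
      (auto simp: std_normal_density_def scaleR_conv_of_real cis_conv_exp mult_ac)
  also have "\<dots> = (1 / complex_of_real (sqrt (2 * pi))) * ft (\<lambda>x. complex_of_real (exp (- x\<^sup>2 / 2))) \<xi>"
    by (simp only: integral_mult_right_zero ft_def)
  finally show ?thesis by (simp add: field_simps)
qed

lemma ft_dilate:
  assumes "n > 0"
  shows "ft (\<lambda>x. f (x / n)) \<xi> = complex_of_real n * ft f (n * \<xi>)"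
  unfolding ft_def using lborel_integral_real_affine[of n "\<lambda>x. cis (- (x * \<xi>)) * f (x / n)" 0] assms
  by (simp add: scaleR_conv_of_real mult_ac)

lemma ft_bound:
  assumes "integrable lborel f"
  shows "cmod (ft f \<xi>) \<le> (LINT x|lborel. cmod (f x))"
  unfolding ft_def using integral_norm_bound[of lborel "\<lambda>x. cis (- (x * \<xi>)) * f x"]
  by (simp add: norm_mult)

lemma autocorrelation_eq_inner: "autocorrelation f t = L2_inner (\<lambda>y. f (y + t)) f"
  by (simp add: autocorrelation_def L2_inner_def)

text \<open>The transform of the Gaussian of width \<open>n\<close> is a Gaussian of width \<open>1/n\<close> and height
  proportional to \<open>n\<close>. The substitution \<open>t = s/n\<close> moves the dependence on \<open>n\<close> into the argument of
  the autocorrelation, which leaves a fixed integrable weight for passing to the limit.\<close>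

lemma gaussian_weighted_plancherel:
  assumes f: "integrable lborel f" and "n > 0"
  shows "(LINT \<xi>|lborel. complex_of_real ((cmod (ft f \<xi>))\<^sup>2 * exp (- (\<xi> / n)\<^sup>2 / 2)))
    = complex_of_real (sqrt (2 * pi))
      * (LINT s|lborel. autocorrelation f (s / n) * complex_of_real (exp (- s\<^sup>2 / 2)))"
proof -
  let ?G = "\<lambda>x. complex_of_real (exp (- x\<^sup>2 / 2))"
  have G: "integrable lborel (\<lambda>x. ?G (x / n))"
    using lborel_integrable_real_affine[OF integrable_gaussian, of "1/n" 0] assms(2)
    by simp
  have ft_G: "ft (\<lambda>x. ?G (x / n)) t = complex_of_real (sqrt (2 * pi) * n) * ?G (n * t)" for t
    using ft_dilate[OF assms(2), of ?G t] ft_gaussian[of "n * t"] by (simp only: of_real_mult mult_ac)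
  have "(LINT \<xi>|lborel. complex_of_real ((cmod (ft f \<xi>))\<^sup>2 * exp (- (\<xi> / n)\<^sup>2 / 2)))
    = (LINT \<xi>|lborel. ft (autocorrelation f) \<xi> * ?G (\<xi> / n))"
    by (simp add: ft_autocorrelation[OF f])
  also have "\<dots> = (LINT t|lborel. autocorrelation f t * ft (\<lambda>x. ?G (x / n)) t)"
    by (intro ft_multiplication_formula integrable_autocorrelation f G)
  also have "\<dots> = (LINT t|lborel. complex_of_real (sqrt (2 * pi) * n) * (autocorrelation f t * ?G (n * t)))"
    unfolding ft_G by (simp only: mult_ac)
  also have "\<dots> = complex_of_real (sqrt (2 * pi)) * (n *\<^sub>R (LINT t|lborel. autocorrelation f t * ?G (n * t)))"
    by (simp only: integral_mult_right_zero scaleR_conv_of_real of_real_mult mult.assoc)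
  also have "n *\<^sub>R (LINT t|lborel. autocorrelation f t * ?G (n * t))
      = (LINT s|lborel. autocorrelation f (s / n) * ?G s)"
  proof -
    have "(LINT t|lborel. autocorrelation f t * ?G (n * t))
        = (1 / n) *\<^sub>R (LINT s|lborel. autocorrelation f (s / n) * ?G s)"
      using lborel_integral_real_affine[of "1/n" "\<lambda>t. autocorrelation f t * ?G (n * t)" 0] assms(2)
      by simp
    then show ?thesis using assms(2) by simp
  qed
  finally show ?thesis .
qed

text \<open>The autocorrelation at \<open>t\<close> is the inner product of the translate of \<open>f\<close> by \<open>t\<close> with \<open>f\<close>: it is
  bounded by \<open>\<parallel>f\<parallel>\<^sup>2\<close> and, by continuity of translation, tends to \<open>\<parallel>f\<parallel>\<^sup>2\<close> as \<open>t\<close> tends to \<open>0\<close>.\<close>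

lemma gaussian_autocorrelation_tendsto:
  assumes f: "integrable lborel f" and f2: "in_L2 f"
  shows "(\<lambda>n. LINT s|lborel. autocorrelation f (s / real (Suc n)) * complex_of_real (exp (- s\<^sup>2 / 2)))
    \<longlonglongrightarrow> complex_of_real (sqrt (2 * pi) * (L2_norm f)\<^sup>2)"
proof -
  let ?G = "\<lambda>x. complex_of_real (exp (- x\<^sup>2 / 2))"
  have [measurable]: "autocorrelation f \<in> borel_measurable borel"
    using borel_measurable_integrable[OF integrable_autocorrelation[OF f]] by simp
  have bound: "cmod (autocorrelation f t) \<le> (L2_norm f)\<^sup>2" for t
    using L2_Cauchy_Schwarz(3)[OF in_L2_shift[OF f2] f2, of t]
    by (simp add: autocorrelation_eq_inner L2_norm_shift[OF f2] power2_eq_square)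
  have lim: "(\<lambda>n. autocorrelation f (s / real (Suc n))) \<longlonglongrightarrow> complex_of_real ((L2_norm f)\<^sup>2)" for s
  proof (rule LIM_zero_cancel, rule Lim_null_comparison)
    have "(\<lambda>n. s / real (Suc n)) \<longlonglongrightarrow> 0"
      using LIMSEQ_Suc[OF lim_const_over_n[of s]] by simp
    from tendsto_mult_left_zero[OF L2_norm_shift_tendsto[OF f2 this], of "L2_norm f"]
    show "(\<lambda>n. L2_norm (\<lambda>y. f (y + s / real (Suc n)) - f y) * L2_norm f) \<longlonglongrightarrow> 0" .
    show "\<forall>\<^sub>F n in sequentially. norm (autocorrelation f (s / real (Suc n)) - complex_of_real ((L2_norm f)\<^sup>2))
        \<le> L2_norm (\<lambda>y. f (y + s / real (Suc n)) - f y) * L2_norm f"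
      unfolding autocorrelation_eq_inner L2_inner_self[symmetric]
      by (intro always_eventually allI, subst L2_inner_diff_left[symmetric])
        (intro L2_Cauchy_Schwarz(3) in_L2_diff in_L2_shift f2)+
  qed
  have "(\<lambda>n. LINT s|lborel. autocorrelation f (s / real (Suc n)) * ?G s)
      \<longlonglongrightarrow> (LINT s|lborel. complex_of_real ((L2_norm f)\<^sup>2) * ?G s)"
  proof (rule integral_dominated_convergence)
    show "integrable lborel (\<lambda>s::real. (L2_norm f)\<^sup>2 * exp (- s\<^sup>2 / 2))"
      by (intro integrable_mult_right integrable_gaussian)
    show "AE s in lborel. (\<lambda>n. autocorrelation f (s / real (Suc n)) * ?G s)
        \<longlonglongrightarrow> complex_of_real ((L2_norm f)\<^sup>2) * ?G s"
      by (intro AE_I2 tendsto_mult lim tendsto_const)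
    show "AE s in lborel. norm (autocorrelation f (s / real (Suc n)) * ?G s) \<le> (L2_norm f)\<^sup>2 * exp (- s\<^sup>2 / 2)" for n
      by (auto simp: norm_mult intro!: AE_I2 mult_right_mono bound)
  qed measurable
  also have "(LINT s|lborel. complex_of_real ((L2_norm f)\<^sup>2) * ?G s)
      = complex_of_real (sqrt (2 * pi) * (L2_norm f)\<^sup>2)"
    by (simp only: integral_mult_right_zero integral_complex_of_real integral_gaussian of_real_mult mult.commute)
  finally show ?thesis .
qed

text \<open>As the Gaussian weights increase to \<open>1\<close>, monotone convergence yields square integrability of
  the transform together with the value of its norm.\<close>

lemma
  assumes f: "integrable lborel f" and f2: "in_L2 f"
  shows in_L2_ft: "in_L2 (ft f)"
    and plancherel_L1_L2: "(L2_norm (ft f))\<^sup>2 = 2 * pi * (L2_norm f)\<^sup>2"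
proof -
  note [measurable] = borel_measurable_integrable[OF f]
  let ?u = "\<lambda>n \<xi>. (cmod (ft f \<xi>))\<^sup>2 * exp (- (\<xi> / real (Suc n))\<^sup>2 / 2)"
  have int: "integrable lborel (?u n)" for n
  proof (rule Bochner_Integration.integrable_bound)
    show "integrable lborel (\<lambda>\<xi>. (LINT x|lborel. cmod (f x))\<^sup>2 * exp (- (\<xi> / real (Suc n))\<^sup>2 / 2))"
      using lborel_integrable_real_affine[OF integrable_gaussian, of "1 / real (Suc n)" 0]
      by (intro integrable_mult_right) simp
    show "AE \<xi> in lborel. norm (?u n \<xi>) \<le> norm ((LINT x|lborel. cmod (f x))\<^sup>2 * exp (- (\<xi> / real (Suc n))\<^sup>2 / 2))"
      by (auto intro!: AE_I2 mult_right_mono power_mono ft_bound[OF f] simp: abs_mult)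
  qed measurable
  have mono: "AE \<xi> in lborel. mono (\<lambda>n. ?u n \<xi>)"
  proof (intro AE_I2 monoI mult_left_mono)
    fix \<xi> :: real and m n :: nat assume "m \<le> n"
    then have "\<bar>\<xi>\<bar> / real (Suc n) \<le> \<bar>\<xi>\<bar> / real (Suc m)"
      by (intro divide_left_mono) auto
    from power_mono[OF this, of 2] show "exp (- (\<xi> / real (Suc m))\<^sup>2 / 2) \<le> exp (- (\<xi> / real (Suc n))\<^sup>2 / 2)"
      by (simp add: power_divide)
  qed simp
  have lim: "AE \<xi> in lborel. (\<lambda>n. ?u n \<xi>) \<longlonglongrightarrow> (cmod (ft f \<xi>))\<^sup>2"
  proof (intro AE_I2)
    fix \<xi> :: real
    have "(\<lambda>n. \<xi> / real (Suc n)) \<longlonglongrightarrow> 0"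
      using LIMSEQ_Suc[OF lim_const_over_n[of \<xi>]] by simp
    then have "(\<lambda>n. ?u n \<xi>) \<longlonglongrightarrow> (cmod (ft f \<xi>))\<^sup>2 * exp (- 0\<^sup>2 / 2)"
      by (intro tendsto_intros) auto
    then show "(\<lambda>n. ?u n \<xi>) \<longlonglongrightarrow> (cmod (ft f \<xi>))\<^sup>2" by simp
  qed
  have "(\<lambda>n. complex_of_real (LINT \<xi>|lborel. ?u n \<xi>))
      \<longlonglongrightarrow> complex_of_real (sqrt (2 * pi)) * complex_of_real (sqrt (2 * pi) * (L2_norm f)\<^sup>2)"
    unfolding integral_complex_of_real[symmetric] gaussian_weighted_plancherel[OF f of_nat_0_less_iff[THEN iffD2, OF zero_less_Suc]]
    by (intro tendsto_mult tendsto_const gaussian_autocorrelation_tendsto f f2)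
  then have "(\<lambda>n. complex_of_real (LINT \<xi>|lborel. ?u n \<xi>)) \<longlonglongrightarrow> complex_of_real (2 * pi * (L2_norm f)\<^sup>2)"
    by (simp add: mult.assoc[symmetric] flip: of_real_mult)
  then have int_lim: "(\<lambda>n. LINT \<xi>|lborel. ?u n \<xi>) \<longlonglongrightarrow> 2 * pi * (L2_norm f)\<^sup>2"
    by (simp only: tendsto_of_real_iff)
  have meas: "(\<lambda>\<xi>. (cmod (ft f \<xi>))\<^sup>2) \<in> borel_measurable lborel" by measurable
  show "in_L2 (ft f)"
    using integrable_monotone_convergence[OF int mono lim int_lim meas]
    by (simp add: in_L2_iff)
  show "(L2_norm (ft f))\<^sup>2 = 2 * pi * (L2_norm f)\<^sup>2"
    using integral_monotone_convergence[OF int mono lim int_lim meas] by (simp add: L2_norm_sq)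
qed

section \<open>The Fourier transform of square integrable functions\<close>

text \<open>Along a subsequence the increments \<open>d\<^sub>k\<close> have norm at most \<open>2\<^sup>-\<^sup>k\<close>. Weighting their squares with
  \<open>2\<^sup>k\<close> still leaves a convergent series of integrals, so \<open>\<Sum> 2\<^sup>k \<bar>d\<^sub>k\<bar>\<^sup>2\<close> is finite almost everywhere. This
  forces absolute convergence of \<open>\<Sum> d\<^sub>k\<close>, because \<open>t \<le> 2\<^sup>k t\<^sup>2 + 2\<^sup>-\<^sup>k\<close> for \<open>t \<ge> 0\<close>. Fatou's lemma turns the
  pointwise limit into a limit in the mean.\<close>

lemma L2_complete:
  assumes f: "\<And>n. in_L2 (f n)"
    and cauchy: "\<And>e. e > 0 \<Longrightarrow> \<exists>N. \<forall>m\<ge>N. \<forall>n\<ge>N. L2_norm (\<lambda>x. f m x - f n x) < e"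
  obtains g where "in_L2 g" "(\<lambda>n::nat. L2_norm (\<lambda>x. f n x - g x)) \<longlonglongrightarrow> 0"
proof -
  have "\<forall>k. \<exists>N. \<forall>m\<ge>N. \<forall>n\<ge>N. L2_norm (\<lambda>x. f m x - f n x) < (1/2)^k"
    using cauchy by simp
  then obtain N where N: "\<And>k m n. m \<ge> N k \<Longrightarrow> n \<ge> N k \<Longrightarrow> L2_norm (\<lambda>x. f m x - f n x) < (1/2)^k"
    by metis
  \<comment> \<open>Partial sums dominate all thresholds up to \<open>k\<close>, so that \<open>r k\<close> serves every smaller index as well.\<close>
  define r where "r k = (\<Sum>i\<le>k. N i)" for k
  have r_ge: "N j \<le> r k" if "j \<le> k" for j k
    unfolding r_def using that by (intro member_le_sum) auto
  have [measurable]: "f n \<in> borel_measurable borel" for n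
    using f by (simp add: in_L2_iff)
  define d where "d k x = f (r (Suc k)) x - f (r k) x" for k x
  have d_L2: "in_L2 (d k)" for k
    unfolding d_def using f by (simp add: in_L2_diff)
  have [measurable]: "d k \<in> borel_measurable borel" for k
    using d_L2 by (simp add: in_L2_iff)
  have d_norm: "2^k * (L2_norm (d k))\<^sup>2 \<le> (1/2)^k" for k
  proof -
    have "L2_norm (d k) < (1/2)^k"
      unfolding d_def by (intro N r_ge) auto
    then have "(L2_norm (d k))\<^sup>2 \<le> ((1/2)^k)\<^sup>2" by (intro power_mono) auto
    then have "2^k * (L2_norm (d k))\<^sup>2 \<le> 2^k * ((1/2)^k)\<^sup>2" by simp
    also have "\<dots> = (1/2)^k" by (simp add: power2_eq_square power_one_over)
    finally show ?thesis .
  qed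
  have "(\<integral>\<^sup>+x. (\<Sum>k. ennreal (2^k * (cmod (d k x))\<^sup>2)) \<partial>lborel)
      = (\<Sum>k. \<integral>\<^sup>+x. ennreal (2^k * (cmod (d k x))\<^sup>2) \<partial>lborel)"
    by (rule nn_integral_suminf) measurable
  also have "\<dots> = (\<Sum>k. ennreal (2^k * (L2_norm (d k))\<^sup>2))"
    using d_L2 by (simp add: ennreal_mult nn_integral_cmult nn_integral_cmod_sq)
  also have "\<dots> \<le> (\<Sum>k. ennreal ((1/2)^k))"
    by (intro suminf_le summableI ennreal_leI d_norm)
  also have "\<dots> < \<infinity>"
    by (subst suminf_ennreal2) (auto intro!: summable_geometric)
  finally have "AE x in lborel. (\<Sum>k. ennreal (2^k * (cmod (d k x))\<^sup>2)) \<noteq> \<infinity>"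
    by (intro nn_integral_PInf_AE) auto
  then have conv: "AE x in lborel. convergent (\<lambda>k. f (r k) x)"
  proof eventually_elim
    case (elim x)
    have "summable (\<lambda>k. 2^k * (cmod (d k x))\<^sup>2)"
      using elim by (intro summable_suminf_not_top) auto
    then have sum: "summable (\<lambda>k. 2^k * (cmod (d k x))\<^sup>2 + (1/2)^k)"
      by (intro summable_add summable_geometric) auto
    have "cmod (d k x) \<le> 2^k * (cmod (d k x))\<^sup>2 + (1/2)^k" for k
    proof (cases "2^k * cmod (d k x) \<ge> 1")
      case True
      from mult_right_mono[OF this, of "cmod (d k x)"] show ?thesis
        by (simp add: power2_eq_square mult.assoc add_increasing2)
    next
      case False
      then have "cmod (d k x) \<le> (1/2)^k" by (simp add: power_one_over field_simps)
      then show ?thesis by (simp add: add_increasing)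
    qed
    then have "summable (\<lambda>k. d k x)"
      by (intro summable_norm_cancel[OF summable_comparison_test[OF _ sum]]) auto
    then have "convergent (\<lambda>n. \<Sum>k<n. d k x)" by (simp add: summable_iff_convergent)
    moreover have "(\<Sum>k<n. d k x) = f (r n) x - f (r 0) x" for n
      unfolding d_def by (rule sum_lessThan_telescope)
    ultimately have "convergent (\<lambda>n. f (r n) x - f (r 0) x)" by simp
    then show ?case using convergent_diff_const_right_iff by blast
  qed
  define g where "g x = lim (\<lambda>k. f (r k) x)" for x
  have [measurable]: "g \<in> borel_measurable borel"
    unfolding g_def by measurable
  have tail: "(\<integral>\<^sup>+x. ennreal ((cmod (f m x - g x))\<^sup>2) \<partial>lborel) \<le> ennreal (((1/2)^j)\<^sup>2)"
    if m: "m \<ge> N j" for m j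
  proof -
    have "(\<integral>\<^sup>+x. ennreal ((cmod (f m x - g x))\<^sup>2) \<partial>lborel)
        = (\<integral>\<^sup>+x. liminf (\<lambda>k. ennreal ((cmod (f m x - f (r k) x))\<^sup>2)) \<partial>lborel)"
    proof (rule nn_integral_cong_AE)
      show "AE x in lborel. ennreal ((cmod (f m x - g x))\<^sup>2)
          = liminf (\<lambda>k. ennreal ((cmod (f m x - f (r k) x))\<^sup>2))"
        using conv
      proof eventually_elim
        case (elim x)
        then have "(\<lambda>k. f (r k) x) \<longlonglongrightarrow> g x" by (simp add: g_def convergent_LIMSEQ_iff)
        then have "(\<lambda>k. ennreal ((cmod (f m x - f (r k) x))\<^sup>2)) \<longlonglongrightarrow> ennreal ((cmod (f m x - g x))\<^sup>2)"
          by (intro tendsto_intros)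
        from lim_imp_Liminf[OF sequentially_bot this] show ?case by simp
      qed
    qed
    also have "\<dots> \<le> liminf (\<lambda>k. \<integral>\<^sup>+x. ennreal ((cmod (f m x - f (r k) x))\<^sup>2) \<partial>lborel)"
      by (intro nn_integral_liminf) measurable
    also have "\<dots> \<le> limsup (\<lambda>k. \<integral>\<^sup>+x. ennreal ((cmod (f m x - f (r k) x))\<^sup>2) \<partial>lborel)"
      by (intro Liminf_le_Limsup) auto
    also have "\<dots> \<le> ennreal (((1/2)^j)\<^sup>2)"
    proof (rule Limsup_bounded)
      show "\<forall>\<^sub>F k in sequentially. (\<integral>\<^sup>+x. ennreal ((cmod (f m x - f (r k) x))\<^sup>2) \<partial>lborel)
          \<le> ennreal (((1/2)^j)\<^sup>2)"
        using eventually_ge_at_top[of j]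
      proof eventually_elim
        case (elim k)
        have "L2_norm (\<lambda>x. f m x - f (r k) x) < (1/2)^j"
          by (intro N m r_ge elim)
        then show ?case
          using f by (simp add: nn_integral_cmod_sq in_L2_diff)
      qed
    qed
    finally show ?thesis .
  qed
  have diff_L2: "in_L2 (\<lambda>x. f m x - g x)" and diff_norm: "(L2_norm (\<lambda>x. f m x - g x))\<^sup>2 \<le> ((1/2)^j)\<^sup>2"
    if m: "m \<ge> N j" for m j
    using in_L2I_nn_integral[OF _ tail[OF m]] by auto
  have "in_L2 g"
    using in_L2_diff[OF f[of "N 0"] diff_L2[of 0 "N 0"]] by simp
  moreover have "(\<lambda>n. L2_norm (\<lambda>x. f n x - g x)) \<longlonglongrightarrow> 0"
  proof (rule LIMSEQ_I)
    fix e :: real assume "e > 0"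
    then obtain j where j: "(1/2)^j < e" using real_arch_pow_inv[of e "1/2"] by auto
    have "L2_norm (\<lambda>x. f n x - g x) < e" if "n \<ge> N j" for n
      using power2_le_imp_le[OF diff_norm[OF that]] j by simp
    then show "\<exists>no. \<forall>n\<ge>no. norm (L2_norm (\<lambda>x. f n x - g x) - 0) < e" by auto
  qed
  ultimately show ?thesis using that by blast
qed

lemma set_integral_eq_ft_truncate:
  "(LINT x:{-R..R}|lborel. cis (- (x * \<xi>)) * u x) = ft (truncate R u) \<xi>"
  by (simp add: set_lebesgue_integral_def ft_def truncate_def)

lemma in_L2_ft_truncate: "in_L2 u \<Longrightarrow> in_L2 (ft (truncate R u))"
  by (intro in_L2_ft integrable_truncate in_L2_truncate)

text \<open>The defining limit in terms of \<open>L2_norm\<close> and \<open>ft\<close>: since truncations have square integrable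
  transforms, the extended integrals are finite, and the triangle inequality becomes available.\<close>

lemma has_fourier_transform_iff:
  "has_fourier_transform u v \<longleftrightarrow> in_L2 u \<and> in_L2 v \<and>
    ((\<lambda>R. L2_norm (\<lambda>\<xi>. v \<xi> - ft (truncate R u) \<xi>)) \<longlongrightarrow> 0) at_top"
proof (cases "in_L2 u \<and> in_L2 v")
  case True
  define a where "a R = L2_norm (\<lambda>\<xi>. v \<xi> - ft (truncate R u) \<xi>)" for R
  have "(\<integral>\<^sup>+\<xi>. ennreal ((cmod (v \<xi> - (LINT x:{-R..R}|lborel. cis (- (x * \<xi>)) * u x)))\<^sup>2) \<partial>lborel)
      = ennreal ((a R)\<^sup>2)" for R
    using True by (simp only: set_integral_eq_ft_truncate a_def nn_integral_cmod_sq in_L2_diff in_L2_ft_truncate)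
  moreover have "((\<lambda>R. ennreal ((a R)\<^sup>2)) \<longlongrightarrow> 0) at_top \<longleftrightarrow> ((\<lambda>R. (a R)\<^sup>2) \<longlongrightarrow> 0) at_top"
    using tendsto_ennreal_iff[of "\<lambda>R. (a R)\<^sup>2" at_top 0] by simp
  moreover have "((\<lambda>R. (a R)\<^sup>2) \<longlongrightarrow> 0) at_top \<longleftrightarrow> (a \<longlongrightarrow> 0) at_top"
  proof
    assume "((\<lambda>R. (a R)\<^sup>2) \<longlongrightarrow> 0) at_top"
    from tendsto_real_sqrt[OF this] show "(a \<longlongrightarrow> 0) at_top" by (simp add: a_def[abs_def])
  next
    assume "(a \<longlongrightarrow> 0) at_top"
    from tendsto_power[OF this, of 2] show "((\<lambda>R. (a R)\<^sup>2) \<longlongrightarrow> 0) at_top" by simp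
  qed
  ultimately show ?thesis
    using True unfolding has_fourier_transform_def a_def by simp
qed (auto simp: has_fourier_transform_def)

lemma L2_norm_truncate_norm_tendsto:
  "in_L2 f \<Longrightarrow> ((\<lambda>R. L2_norm (truncate R f)) \<longlongrightarrow> L2_norm f) at_top"
  by (intro L2_norm_tendsto L2_norm_truncate_tendsto in_L2_truncate)

text \<open>Both sides are limits of the identity for the truncations of \<open>u\<close>.\<close>

theorem parseval:
  assumes "has_fourier_transform u v"
  shows "(L2_norm v)\<^sup>2 = 2 * pi * (L2_norm u)\<^sup>2"
proof (rule tendsto_unique)
  have u: "in_L2 u" and v: "in_L2 v"
    and lim: "((\<lambda>R. L2_norm (\<lambda>\<xi>. ft (truncate R u) \<xi> - v \<xi>)) \<longlongrightarrow> 0) at_top"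
    using assms L2_norm_minus_commute[of v] by (auto simp: has_fourier_transform_iff)
  show "((\<lambda>R. (L2_norm (ft (truncate R u)))\<^sup>2) \<longlongrightarrow> (L2_norm v)\<^sup>2) at_top"
    by (intro tendsto_power L2_norm_tendsto lim v in_L2_ft_truncate u)
  show "((\<lambda>R. (L2_norm (ft (truncate R u)))\<^sup>2) \<longlongrightarrow> 2 * pi * (L2_norm u)\<^sup>2) at_top"
    by (simp only: plancherel_L1_L2 integrable_truncate in_L2_truncate u)
      (intro tendsto_intros L2_norm_truncate_norm_tendsto u)
qed simp

lemma has_fourier_transform_unique_AE:
  assumes "has_fourier_transform u v" "has_fourier_transform u v'"
  shows "AE \<xi> in lborel. v \<xi> = v' \<xi>"
  by (rule AE_eq_if_L2_limits[where f = "\<lambda>R. ft (truncate R u)" and F = at_top])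
    (use assms in \<open>auto simp: has_fourier_transform_iff in_L2_ft_truncate\<close>)

text \<open>Multipliers see a transform only up to null sets, hence this replacement is harmless.\<close>

lemma has_fourier_transform_cong_AE:
  assumes "has_fourier_transform u v" "in_L2 v'" "AE \<xi> in lborel. v \<xi> = v' \<xi>"
  shows "has_fourier_transform u v'"
proof -
  have "L2_norm (\<lambda>\<xi>. v' \<xi> - ft (truncate R u) \<xi>) = L2_norm (\<lambda>\<xi>. v \<xi> - ft (truncate R u) \<xi>)" for R
    using assms by (intro L2_norm_cong_AE in_L2_diff in_L2_ft_truncate)
      (auto simp: has_fourier_transform_iff)
  then show ?thesis using assms by (simp add: has_fourier_transform_iff)
qed

lemma has_fourier_transform_diff:
  assumes "has_fourier_transform u v" "has_fourier_transform u' v'"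
  shows "has_fourier_transform (\<lambda>x. u x - u' x) (\<lambda>\<xi>. v \<xi> - v' \<xi>)"
proof -
  have L2: "in_L2 u" "in_L2 u'" "in_L2 v" "in_L2 v'"
    and lim: "((\<lambda>R. L2_norm (\<lambda>\<xi>. v \<xi> - ft (truncate R u) \<xi>)) \<longlongrightarrow> 0) at_top"
      "((\<lambda>R. L2_norm (\<lambda>\<xi>. v' \<xi> - ft (truncate R u') \<xi>)) \<longlongrightarrow> 0) at_top"
    using assms by (auto simp: has_fourier_transform_iff)
  have "ft (truncate R (\<lambda>x. u x - u' x)) \<xi> = ft (truncate R u) \<xi> - ft (truncate R u') \<xi>" for R \<xi>
    using ft_diff[OF integrable_truncate[OF L2(1)] integrable_truncate[OF L2(2)]]
    by (simp add: truncate_def scaleR_right_diff_distrib)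
  then have eq: "(\<lambda>\<xi>. v \<xi> - v' \<xi> - ft (truncate R (\<lambda>x. u x - u' x)) \<xi>)
      = (\<lambda>\<xi>. (v \<xi> - ft (truncate R u) \<xi>) - (v' \<xi> - ft (truncate R u') \<xi>))" for R
    by (auto simp: fun_eq_iff)
  have "((\<lambda>R. L2_norm (\<lambda>\<xi>. v \<xi> - v' \<xi> - ft (truncate R (\<lambda>x. u x - u' x)) \<xi>)) \<longlongrightarrow> 0) at_top"
  proof (rule Lim_null_comparison)
    show "((\<lambda>R. L2_norm (\<lambda>\<xi>. v \<xi> - ft (truncate R u) \<xi>)
        + L2_norm (\<lambda>\<xi>. v' \<xi> - ft (truncate R u') \<xi>)) \<longlongrightarrow> 0) at_top"
      using tendsto_add[OF lim] by simp
    have "L2_norm (\<lambda>\<xi>. v \<xi> - v' \<xi> - ft (truncate R (\<lambda>x. u x - u' x)) \<xi>)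
        \<le> L2_norm (\<lambda>\<xi>. v \<xi> - ft (truncate R u) \<xi>) + L2_norm (\<lambda>\<xi>. v' \<xi> - ft (truncate R u') \<xi>)" for R
      unfolding eq using L2 by (intro L2_norm_diff_le in_L2_diff in_L2_ft_truncate)
    then show "\<forall>\<^sub>F R in at_top. norm (L2_norm (\<lambda>\<xi>. v \<xi> - v' \<xi> - ft (truncate R (\<lambda>x. u x - u' x)) \<xi>))
        \<le> L2_norm (\<lambda>\<xi>. v \<xi> - ft (truncate R u) \<xi>) + L2_norm (\<lambda>\<xi>. v' \<xi> - ft (truncate R u') \<xi>)"
      by simp
  qed
  then show ?thesis using L2 by (simp add: has_fourier_transform_iff in_L2_diff)
qed

lemma
  assumes f: "in_L2 f"
  shows in_L2_reflect: "in_L2 (\<lambda>x. f (- x))" and L2_norm_reflect: "L2_norm (\<lambda>x. f (- x)) = L2_norm f"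
proof -
  have [measurable]: "f \<in> borel_measurable borel" using f by (simp add: in_L2_iff)
  have "(\<lambda>x. f (- x)) \<in> borel_measurable borel" by measurable
  then show "in_L2 (\<lambda>x. f (- x))"
    unfolding in_L2_iff using lborel_integrable_real_affine[OF in_L2_integrable_sq[OF f], of "-1" 0] by simp
  show "L2_norm (\<lambda>x. f (- x)) = L2_norm f"
    unfolding L2_norm_def using lborel_integral_real_affine[of "-1" "\<lambda>x. (cmod (f x))\<^sup>2" 0] by simp
qed

lemma ft_cnj: "ft (\<lambda>x. cnj (f x)) \<xi> = cnj (ft f (- \<xi>))"
  by (simp add: ft_def cis_cnj flip: Bochner_Integration.integral_cnj)

text \<open>The preimage \<open>w\<close> is the limit in the mean of the inverse transforms of the truncations of \<open>v\<close>;
  these form a Cauchy sequence since the inverse transform is a multiple of an isometry. To see that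
  \<open>w\<close> has transform \<open>v\<close>, let \<open>W\<close> be a truncation of \<open>w\<close>. The multiplication formula gives
  \<open>\<langle>\<F> W, v\<rangle> = 2 \<pi> \<langle>W, w\<rangle> = 2 \<pi> \<parallel>W\<parallel>\<^sup>2\<close>, so expanding the square shows
  \<open>\<parallel>v - \<F> W\<parallel>\<^sup>2 = \<parallel>v\<parallel>\<^sup>2 - 2 \<pi> \<parallel>W\<parallel>\<^sup>2\<close>, which tends to \<open>\<parallel>v\<parallel>\<^sup>2 - 2 \<pi> \<parallel>w\<parallel>\<^sup>2 = 0\<close>.\<close>

theorem fourier_transform_surj:
  assumes v: "in_L2 v"
  obtains w where "has_fourier_transform w v"
proof -
  define V where "V n = truncate (real n) v" for n
  define g where "g n x = complex_of_real (1 / (2 * pi)) * ft (V n) (- x)" for n x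
  have V: "in_L2 (V n)" "integrable lborel (V n)" for n
    unfolding V_def using v by (auto intro: in_L2_truncate integrable_truncate)
  have V_lim: "(\<lambda>n. L2_norm (\<lambda>x. V n x - v x)) \<longlonglongrightarrow> 0"
    unfolding V_def by (rule filterlim_compose[OF L2_norm_truncate_tendsto[OF v] filterlim_real_sequentially])
  have g: "in_L2 (g n)" for n
    unfolding g_def by (intro in_L2_cmult in_L2_reflect in_L2_ft V)
  have inv_norm: "(L2_norm (\<lambda>x. complex_of_real (1 / (2 * pi)) * ft h (- x)))\<^sup>2 = (L2_norm h)\<^sup>2 / (2 * pi)"
    if "in_L2 h" "integrable lborel h" for h
    using that unfolding L2_norm_cmult power_mult_distrib
    by (simp add: L2_norm_reflect in_L2_ft plancherel_L1_L2 norm_divide) (simp add: power2_eq_square)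
  have g_diff: "(L2_norm (\<lambda>x. g m x - g n x))\<^sup>2 = (L2_norm (\<lambda>x. V m x - V n x))\<^sup>2 / (2 * pi)" for m n
    using inv_norm[of "\<lambda>x. V m x - V n x"] V
    by (simp add: g_def ft_diff in_L2_diff right_diff_distrib)
  have g_diff_le: "L2_norm (\<lambda>x. g m x - g n x) \<le> L2_norm (\<lambda>x. V m x - V n x)" for m n
  proof (rule power2_le_imp_le)
    show "(L2_norm (\<lambda>x. g m x - g n x))\<^sup>2 \<le> (L2_norm (\<lambda>x. V m x - V n x))\<^sup>2"
      unfolding g_diff using pi_gt3 by (intro divide_le_eq[THEN iffD2]) (auto simp: mult_le_cancel_left1)
  qed simp
  have "\<exists>N. \<forall>m\<ge>N. \<forall>n\<ge>N. L2_norm (\<lambda>x. g m x - g n x) < e" if "e > 0" for e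
  proof -
    have "\<forall>\<^sub>F n in sequentially. L2_norm (\<lambda>x. V n x - v x) < e / 2"
      by (rule order_tendstoD(2)[OF V_lim]) (use that in simp)
    then obtain N where N: "\<And>n. n \<ge> N \<Longrightarrow> L2_norm (\<lambda>x. V n x - v x) < e / 2"
      by (auto simp: eventually_sequentially simp del: less_divide_eq_numeral1)
    have "L2_norm (\<lambda>x. g m x - g n x) < e" if "m \<ge> N" "n \<ge> N" for m n
      using N[OF that(1)] N[OF that(2)] L2_norm_triangle_diff[OF V(1) v V(1), of m n]
        g_diff_le[of m n] L2_norm_minus_commute[of v "V n"] by linarith
    then show ?thesis by blast
  qed
  then obtain w where w: "in_L2 w" and w_lim: "(\<lambda>n. L2_norm (\<lambda>x. g n x - w x)) \<longlonglongrightarrow> 0"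
    using L2_complete[of g] g by blast
  have w_norm: "2 * pi * (L2_norm w)\<^sup>2 = (L2_norm v)\<^sup>2"
  proof (rule LIMSEQ_unique)
    show "(\<lambda>n. 2 * pi * (L2_norm (g n))\<^sup>2) \<longlonglongrightarrow> 2 * pi * (L2_norm w)\<^sup>2"
      by (intro tendsto_intros L2_norm_tendsto w_lim g w)
    have "2 * pi * (L2_norm (g n))\<^sup>2 = (L2_norm (V n))\<^sup>2" for n
      using inv_norm[OF V, of n] by (simp add: g_def[abs_def])
    then show "(\<lambda>n. 2 * pi * (L2_norm (g n))\<^sup>2) \<longlonglongrightarrow> (L2_norm v)\<^sup>2"
      using tendsto_power[OF L2_norm_tendsto[OF V(1) v V_lim], of 2] by simp
  qed
  have error: "(L2_norm (\<lambda>\<xi>. v \<xi> - ft (truncate R w) \<xi>))\<^sup>2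
      = (L2_norm v)\<^sup>2 - 2 * pi * (L2_norm (truncate R w))\<^sup>2" for R
  proof -
    let ?W = "truncate R w"
    have W: "in_L2 ?W" "integrable lborel ?W" using w by (auto intro: in_L2_truncate integrable_truncate)
    have "L2_inner (ft ?W) v = complex_of_real (2 * pi) * L2_inner ?W w"
    proof (rule LIMSEQ_unique)
      show "(\<lambda>n. L2_inner (ft ?W) (V n)) \<longlonglongrightarrow> L2_inner (ft ?W) v"
        by (intro L2_inner_tendsto_right V v V_lim in_L2_ft W)
      have "L2_inner (ft ?W) (V n) = complex_of_real (2 * pi) * L2_inner ?W (g n)" for n
      proof -
        have "L2_inner (ft ?W) (V n) = (LINT x|lborel. ?W x * ft (\<lambda>x. cnj (V n x)) x)"
          unfolding L2_inner_def by (intro ft_multiplication_formula W) (use V in simp)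
        also have "\<dots> = (LINT x|lborel. complex_of_real (2 * pi) * (?W x * cnj (g n x)))"
          by (simp add: ft_cnj g_def)
        finally show ?thesis by (simp only: L2_inner_def integral_mult_right_zero)
      qed
      then show "(\<lambda>n. L2_inner (ft ?W) (V n)) \<longlonglongrightarrow> complex_of_real (2 * pi) * L2_inner ?W w"
        by (simp only:) (intro tendsto_intros L2_inner_tendsto_right g w w_lim W)
    qed
    also have "L2_inner ?W w = L2_inner ?W ?W"
      unfolding L2_inner_def
      by (intro Bochner_Integration.integral_cong) (auto simp: truncate_def indicator_def)
    finally have "Re (L2_inner (ft ?W) v) = 2 * pi * (L2_norm ?W)\<^sup>2"
      by (simp add: L2_inner_self flip: of_real_mult of_real_power)
    then show ?thesis
      using L2_norm_diff_sq[OF in_L2_ft[OF W(2,1)] v] plancherel_L1_L2[OF W(2,1)]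
      by (subst L2_norm_minus_commute) simp
  qed
  have "((\<lambda>R. (L2_norm v)\<^sup>2 - 2 * pi * (L2_norm (truncate R w))\<^sup>2)
      \<longlongrightarrow> (L2_norm v)\<^sup>2 - 2 * pi * (L2_norm w)\<^sup>2) at_top"
    by (intro tendsto_intros L2_norm_truncate_norm_tendsto w)
  then have "((\<lambda>R. (L2_norm (\<lambda>\<xi>. v \<xi> - ft (truncate R w) \<xi>))\<^sup>2) \<longlongrightarrow> 0) at_top"
    unfolding error w_norm by simp
  from tendsto_real_sqrt[OF this]
  have "has_fourier_transform w v" using v w by (simp add: has_fourier_transform_iff)
  then show ?thesis by (rule that)
qed

text \<open>The choice in \<open>fourier_multiplier\<close> also picks a representative of the transform of \<open>u\<close>.
  Uniqueness up to null sets lets any given representative \<open>v\<close> take its place.\<close>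

lemma has_fourier_transform_multiplier:
  assumes uv: "has_fourier_transform u v" and mv: "in_L2 (\<lambda>\<xi>. m \<xi> * v \<xi>)"
  shows "has_fourier_transform (fourier_multiplier m u) (\<lambda>\<xi>. m \<xi> * v \<xi>)"
proof -
  obtain w where "has_fourier_transform w (\<lambda>\<xi>. m \<xi> * v \<xi>)"
    using fourier_transform_surj[OF mv] .
  then have "\<exists>w v'. has_fourier_transform u v' \<and> has_fourier_transform w (\<lambda>\<xi>. m \<xi> * v' \<xi>)"
    using uv by blast
  from someI_ex[OF this] obtain v' where v': "has_fourier_transform u v'"
    "has_fourier_transform (fourier_multiplier m u) (\<lambda>\<xi>. m \<xi> * v' \<xi>)"
    unfolding fourier_multiplier_def by blast
  have "AE \<xi> in lborel. m \<xi> * v' \<xi> = m \<xi> * v \<xi>"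
    using has_fourier_transform_unique_AE[OF v'(1) uv] by eventually_elim simp
  then show ?thesis
    by (rule has_fourier_transform_cong_AE[OF v'(2) mv])
qed

section \<open>Norms and Sobolev regularity of multipliers\<close>

lemma L2_norm_fourier:
  assumes "has_fourier_transform u v"
  shows "L2_norm v = sqrt (2 * pi) * L2_norm u"
  using arg_cong[OF parseval[OF assms], of sqrt] by (simp add: real_sqrt_mult)

lemma L2_norm_le_fourier:
  assumes "has_fourier_transform f v" "has_fourier_transform g w" "C \<ge> 0"
    and "\<And>\<xi>. cmod (v \<xi>) \<le> C * cmod (w \<xi>)"
  shows "L2_norm f \<le> C * L2_norm g"
proof -
  have "L2_norm v \<le> C * L2_norm w"
    using assms by (intro L2_norm_dominated) (auto simp: has_fourier_transform_iff)
  then have "sqrt (2 * pi) * L2_norm f \<le> sqrt (2 * pi) * (C * L2_norm g)"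
    using assms by (simp add: L2_norm_fourier[OF assms(1)] L2_norm_fourier[OF assms(2)] mult_ac)
  then show ?thesis by (rule mult_left_le_imp_le) simp
qed

text \<open>The bound on the symbols is required only where the transform is supported; this is what
  the frequency cut provides.\<close>

lemma multiplier_norm_mono:
  assumes "has_fourier_transform f v" "in_L2 (\<lambda>\<xi>. m \<xi> * v \<xi>)" "in_L2 (\<lambda>\<xi>. k \<xi> * v \<xi>)" "C \<ge> 0"
    and "\<And>\<xi>. v \<xi> \<noteq> 0 \<Longrightarrow> cmod (m \<xi>) \<le> C * cmod (k \<xi>)"
  shows "L2_norm (fourier_multiplier m f) \<le> C * L2_norm (fourier_multiplier k f)"
proof (rule L2_norm_le_fourier[OF has_fourier_transform_multiplier has_fourier_transform_multiplier])
  fix \<xi> show "cmod (m \<xi> * v \<xi>) \<le> C * cmod (k \<xi> * v \<xi>)"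
    using mult_right_mono[OF assms(5)[of \<xi>], of "cmod (v \<xi>)"]
    by (cases "v \<xi> = 0") (auto simp: norm_mult mult.assoc)
qed (use assms in auto)

text \<open>The symbol may vanish at the origin, a null set.\<close>

lemma AE_eq_0_if_multiplier_norm_eq_0:
  assumes "has_fourier_transform f v" "in_L2 (\<lambda>\<xi>. m \<xi> * v \<xi>)" "\<And>\<xi>. \<xi> \<noteq> 0 \<Longrightarrow> m \<xi> \<noteq> 0"
    and "L2_norm (fourier_multiplier m f) = 0"
  shows "AE x in lborel. f x = 0"
proof -
  have "L2_norm (\<lambda>\<xi>. m \<xi> * v \<xi>) = 0"
    using L2_norm_fourier[OF has_fourier_transform_multiplier[OF assms(1,2)]] assms(4) by simp
  then have "AE \<xi> in lborel. m \<xi> * v \<xi> = 0"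
    using L2_norm_eq_0_iff_AE[OF assms(2)] by simp
  moreover have "AE \<xi> in lborel. \<xi> \<noteq> (0::real)" by (rule AE_lborel_singleton)
  ultimately have "AE \<xi> in lborel. v \<xi> = 0"
    by eventually_elim (use assms(3) in auto)
  then have "L2_norm v = 0" using assms(1) L2_norm_eq_0_iff_AE by (simp add: has_fourier_transform_iff)
  then have "L2_norm f = 0" using L2_norm_fourier[OF assms(1)] by simp
  then show ?thesis using assms(1) L2_norm_eq_0_iff_AE by (simp add: has_fourier_transform_iff)
qed

lemma Lq_norm_pow_eq_0:
  assumes "AE x in lborel. f x = 0"
  shows "Lq_norm_pow q f = 0"
proof -
  have "Lq_norm_pow q f = (\<integral>\<^sup>+x. 0 \<partial>(lborel :: real measure))"
    unfolding Lq_norm_pow_def using assms by (intro nn_integral_cong_AE) auto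
  then show ?thesis by simp
qed

lemma sq_powr_half: "(t powr (s / 2))\<^sup>2 = t powr s" for t s :: real
  by (simp add: power2_eq_square flip: powr_add)

lemma in_L2_of_Sobolev:
  assumes "has_fourier_transform u v" "s \<ge> 0"
    "(\<integral>\<^sup>+\<xi>. ennreal ((1 + \<xi>\<^sup>2) powr s * (cmod (v \<xi>))\<^sup>2) \<partial>lborel) < \<infinity>"
  shows "in_L2 (\<lambda>\<xi>. complex_of_real ((1 + \<xi>\<^sup>2) powr (s / 2)) * v \<xi>)"
proof -
  have [measurable]: "v \<in> borel_measurable borel"
    using assms(1) by (simp add: has_fourier_transform_iff in_L2_iff)
  have "(cmod (complex_of_real ((1 + \<xi>\<^sup>2) powr (s / 2)) * v \<xi>))\<^sup>2 = (1 + \<xi>\<^sup>2) powr s * (cmod (v \<xi>))\<^sup>2" for \<xi>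
    by (simp add: norm_mult power_mult_distrib sq_powr_half)
  then show ?thesis using assms(3) by (simp add: in_L2_def)
qed

lemma in_L2_multiplier_Sobolev:
  assumes "has_fourier_transform u v" "s \<ge> 0"
    "(\<integral>\<^sup>+\<xi>. ennreal ((1 + \<xi>\<^sup>2) powr s * (cmod (v \<xi>))\<^sup>2) \<partial>lborel) < \<infinity>"
    and [measurable]: "m \<in> borel_measurable borel" and "C \<ge> 0"
    and m: "\<And>\<xi>. (cmod (m \<xi>))\<^sup>2 \<le> C * (1 + \<xi>\<^sup>2) powr s"
  shows "in_L2 (\<lambda>\<xi>. m \<xi> * v \<xi>)"
proof (rule in_L2_dominated[OF in_L2_of_Sobolev[OF assms(1-3)]])
  have [measurable]: "v \<in> borel_measurable borel"
    using assms(1) by (simp add: has_fourier_transform_iff in_L2_iff)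
  show "(\<lambda>\<xi>. m \<xi> * v \<xi>) \<in> borel_measurable borel" by measurable
  fix \<xi>
  have "cmod (m \<xi>) \<le> sqrt C * (1 + \<xi>\<^sup>2) powr (s / 2)"
  proof (rule power2_le_imp_le)
    have "(sqrt C * (1 + \<xi>\<^sup>2) powr (s / 2))\<^sup>2 = C * (1 + \<xi>\<^sup>2) powr s"
      using \<open>C \<ge> 0\<close> by (simp add: power_mult_distrib sq_powr_half)
    then show "(cmod (m \<xi>))\<^sup>2 \<le> (sqrt C * (1 + \<xi>\<^sup>2) powr (s / 2))\<^sup>2" using m[of \<xi>] by simp
  qed (use \<open>C \<ge> 0\<close> in simp)
  from mult_right_mono[OF this, of "cmod (v \<xi>)"]
  show "cmod (m \<xi> * v \<xi>) \<le> sqrt C * cmod (complex_of_real ((1 + \<xi>\<^sup>2) powr (s / 2)) * v \<xi>)"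
    by (simp add: norm_mult mult_ac)
qed

lemma abs_le_sqrt_1_sq: "\<bar>\<xi>::real\<bar> \<le> sqrt (1 + \<xi>\<^sup>2)"
proof -
  have "\<bar>\<xi>\<bar> = sqrt (\<xi>\<^sup>2)" by simp
  also have "\<dots> \<le> sqrt (1 + \<xi>\<^sup>2)" by (rule real_sqrt_le_mono) simp
  finally show ?thesis .
qed

section \<open>Gagliardo--Nirenberg inequalities and splitting of norms\<close>

text \<open>For \<open>X > 0\<close> one divides by \<open>X\<close>. For \<open>X = 0\<close> the right-hand side is \<open>0\<close> even if
  every constant is infinite, so the claim amounts to \<open>L = 0\<close>.\<close>

lemma le_Inf_constants:
  fixes L :: ennreal and X :: real
  assumes "X = 0 \<Longrightarrow> L = 0" "X \<ge> 0" "\<And>C. C \<in> S \<Longrightarrow> L \<le> C * ennreal X"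
  shows "L \<le> Inf S * ennreal X"
proof (cases "X = 0")
  case False
  then have X: "ennreal X \<noteq> 0" "ennreal X \<noteq> top" using assms(2) by auto
  have "L / ennreal X \<le> Inf S"
  proof (rule Inf_greatest)
    fix C assume "C \<in> S"
    from divide_right_mono_ennreal[OF assms(3)[OF this], of "ennreal X"]
    show "L / ennreal X \<le> C" using X by (simp add: ennreal_mult_divide_eq)
  qed
  then have "L / ennreal X * ennreal X \<le> Inf S * ennreal X" by (rule mult_right_mono) simp
  then show ?thesis using X by (simp add: ennreal_divide_times ennreal_divide_self less_top)
qed (use assms in auto)

lemma gagliardo_nirenberg_one:
  assumes "p > 1" "in_Sobolev 1 f"
  shows "Lq_norm_pow (p + 1) f
    \<le> GN_const_one p * ennreal (L2_norm f powr ((p + 3) / 2) * L2_norm (dx f) powr ((p - 1) / 2))"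
  unfolding GN_const_one_def
proof (rule le_Inf_constants)
  assume 0: "L2_norm f powr ((p + 3) / 2) * L2_norm (dx f) powr ((p - 1) / 2) = 0"
  obtain v where v: "has_fourier_transform f v"
    "(\<integral>\<^sup>+\<xi>. ennreal ((1 + \<xi>\<^sup>2) powr 1 * (cmod (v \<xi>))\<^sup>2) \<partial>lborel) < \<infinity>"
    using assms(2) unfolding in_Sobolev_def by blast
  have "in_L2 (\<lambda>\<xi>. (\<i> * complex_of_real \<xi>) * v \<xi>)"
    by (rule in_L2_multiplier_Sobolev[OF v(1) _ v(2), of _ 1]) (auto simp: norm_mult)
  then have "AE x in lborel. f x = 0" if "L2_norm (dx f) = 0"
    using AE_eq_0_if_multiplier_norm_eq_0[OF v(1)] that by (simp add: dx_def)
  moreover have "AE x in lborel. f x = 0" if "L2_norm f = 0"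
    using that v(1) L2_norm_eq_0_iff_AE by (simp add: has_fourier_transform_iff)
  ultimately show "Lq_norm_pow (p + 1) f = 0"
    using 0 by (intro Lq_norm_pow_eq_0) auto
qed (use assms in auto)

lemma gagliardo_nirenberg_half:
  assumes "p > 1" "in_Sobolev (1/2) f"
  shows "Lq_norm_pow (p + 1) f
    \<le> GN_const_half p * ennreal ((L2_norm f)\<^sup>2 * L2_norm (abs_dx_half f) powr (p - 1))"
  unfolding GN_const_half_def
proof (rule le_Inf_constants)
  assume 0: "(L2_norm f)\<^sup>2 * L2_norm (abs_dx_half f) powr (p - 1) = 0"
  obtain v where v: "has_fourier_transform f v"
    "(\<integral>\<^sup>+\<xi>. ennreal ((1 + \<xi>\<^sup>2) powr (1/2) * (cmod (v \<xi>))\<^sup>2) \<partial>lborel) < \<infinity>"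
    using assms(2) unfolding in_Sobolev_def by blast
  have "in_L2 (\<lambda>\<xi>. complex_of_real (\<bar>\<xi>\<bar> powr (1/2)) * v \<xi>)"
    by (rule in_L2_multiplier_Sobolev[OF v(1) _ v(2), of _ 1])
      (auto simp: powr_half_sqrt abs_le_sqrt_1_sq)
  then have "AE x in lborel. f x = 0" if "L2_norm (abs_dx_half f) = 0"
    using AE_eq_0_if_multiplier_norm_eq_0[OF v(1)] that by (simp add: abs_dx_half_def)
  moreover have "AE x in lborel. f x = 0" if "L2_norm f = 0"
    using that v(1) L2_norm_eq_0_iff_AE by (simp add: has_fourier_transform_iff)
  ultimately show "Lq_norm_pow (p + 1) f = 0"
    using 0 by (intro Lq_norm_pow_eq_0) auto
qed (use assms in auto)

text \<open>Convexity of the power at the midpoint of two positive numbers; if one of the numbers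
  vanishes, the claim amounts to \<open>2 \<le> 2\<^sup>q\<close>.\<close>

lemma powr_add_le:
  fixes x y q :: real
  assumes "x \<ge> 0" "y \<ge> 0" "q \<ge> 1"
  shows "(x + y) powr q \<le> 2 powr (q - 1) * (x powr q + y powr q)"
proof -
  have "((x + y) / 2) powr q \<le> (x powr q + y powr q) / 2"
  proof (cases "x = 0 \<or> y = 0")
    case True
    have "2 powr q \<ge> 2 powr 1" using assms(3) by (intro powr_mono) auto
    then have "z powr q * 2 \<le> z powr q * 2 powr q" for z :: real by (intro mult_left_mono) auto
    then have "z powr q / 2 powr q \<le> z powr q / 2" for z :: real by (simp add: field_simps)
    then show ?thesis using True assms by (auto simp: powr_divide)
  next
    case False
    have "((1 - 1/2) *\<^sub>R x + (1/2) *\<^sub>R y) powr q \<le> (1 - 1/2) * x powr q + (1/2) * y powr q"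
      by (rule convex_onD[OF powr_convex]) (use assms False in auto)
    then show ?thesis by (simp add: add_divide_distrib)
  qed
  moreover have "((x + y) / 2) powr q = (x + y) powr q / 2 powr q"
    using assms by (simp add: powr_divide)
  ultimately show ?thesis
    by (simp add: powr_diff field_simps)
qed

lemma Lq_norm_pow_add_le:
  assumes [measurable]: "f \<in> borel_measurable borel" "g \<in> borel_measurable borel" and q: "q \<ge> 1"
  shows "Lq_norm_pow q (\<lambda>x. f x + g x)
    \<le> ennreal (2 powr (q - 1)) * (Lq_norm_pow q f + Lq_norm_pow q g)"
proof -
  have "cmod (f x + g x) powr q \<le> 2 powr (q - 1) * (cmod (f x) powr q + cmod (g x) powr q)" for x
  proof -
    have "cmod (f x + g x) powr q \<le> (cmod (f x) + cmod (g x)) powr q"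
      using q by (intro powr_mono2 norm_triangle_ineq) auto
    also have "\<dots> \<le> 2 powr (q - 1) * (cmod (f x) powr q + cmod (g x) powr q)"
      using q by (intro powr_add_le) auto
    finally show ?thesis .
  qed
  then have "Lq_norm_pow q (\<lambda>x. f x + g x)
      \<le> (\<integral>\<^sup>+x. ennreal (2 powr (q - 1) * (cmod (f x) powr q + cmod (g x) powr q)) \<partial>lborel)"
    unfolding Lq_norm_pow_def by (intro nn_integral_mono ennreal_leI)
  also have "\<dots> = ennreal (2 powr (q - 1)) * (Lq_norm_pow q f + Lq_norm_pow q g)"
    by (simp add: Lq_norm_pow_def ennreal_mult nn_integral_cmult nn_integral_add)
  finally show ?thesis .
qed

section \<open>Bounds on the symbol\<close>

lemma H_symbol_nonneg: "H_symbol c \<xi> \<ge> 0"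
proof -
  have "sqrt ((c\<^sup>2 / 2)\<^sup>2) \<le> sqrt (c\<^sup>2 * \<bar>\<xi>\<bar>\<^sup>2 + c ^ 4 / 4)"
    by (intro real_sqrt_le_mono) (simp add: power_divide)
  then show ?thesis by (simp add: H_symbol_def)
qed

text \<open>Moving \<open>c\<^sup>2/2\<close> to the other side and squaring reduces lower bounds to polynomial
  inequalities.\<close>

lemma H_symbol_ge:
  assumes "(b + c\<^sup>2 / 2)\<^sup>2 \<le> c\<^sup>2 * \<bar>\<xi>\<bar>\<^sup>2 + c ^ 4 / 4"
  shows "H_symbol c \<xi> \<ge> b"
  using real_le_rsqrt[OF assms] by (simp add: H_symbol_def)

text \<open>After squaring, the claim reads \<open>\<xi>\<^sup>4/4 \<le> c\<^sup>2 \<xi>\<^sup>2/2\<close>, which follows from \<open>\<xi>\<^sup>2 \<le> c\<^sup>2\<close>.\<close>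

lemma H_symbol_ge_low:
  assumes "\<bar>\<xi>\<bar> \<le> c"
  shows "\<xi>\<^sup>2 / 2 \<le> H_symbol c \<xi>"
proof (rule H_symbol_ge)
  have "\<xi>\<^sup>2 \<le> c\<^sup>2" using assms power_mono[OF assms, of 2] by simp
  then have "\<xi>\<^sup>2 * \<xi>\<^sup>2 \<le> c\<^sup>2 * \<xi>\<^sup>2" by (rule mult_right_mono) simp
  moreover have "(\<xi>\<^sup>2 / 2 + c\<^sup>2 / 2)\<^sup>2 = \<xi>\<^sup>2 * \<xi>\<^sup>2 / 4 + c\<^sup>2 * \<xi>\<^sup>2 / 2 + c ^ 4 / 4"
    by (simp add: power2_eq_square power4_eq_xxxx field_simps)
  moreover have "0 \<le> c\<^sup>2 * \<xi>\<^sup>2" by simp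
  ultimately show "(\<xi>\<^sup>2 / 2 + c\<^sup>2 / 2)\<^sup>2 \<le> c\<^sup>2 * \<bar>\<xi>\<bar>\<^sup>2 + c ^ 4 / 4"
    unfolding power2_abs by linarith
qed

text \<open>After squaring, the claim reads \<open>(a \<xi>)\<^sup>2/4 + c\<^sup>2 a \<bar>\<xi>\<bar>/2 \<le> c\<^sup>2 \<xi>\<^sup>2\<close>; the left-hand side is at most
  \<open>3/4\<close> of the right-hand side, using \<open>a \<le> c\<close> for the first term and \<open>a \<le> \<bar>\<xi>\<bar>\<close> for the second.\<close>

lemma H_symbol_ge_high:
  assumes "0 \<le> a" "a \<le> c" "a \<le> \<bar>\<xi>\<bar>"
  shows "a * \<bar>\<xi>\<bar> / 2 \<le> H_symbol c \<xi>"
proof (rule H_symbol_ge)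
  have "c\<^sup>2 * (a * \<bar>\<xi>\<bar>) \<le> c\<^sup>2 * (\<bar>\<xi>\<bar> * \<bar>\<xi>\<bar>)"
    using assms by (intro mult_left_mono mult_right_mono) auto
  then have "c\<^sup>2 * (a * \<bar>\<xi>\<bar>) \<le> c\<^sup>2 * \<xi>\<^sup>2" by (simp add: power2_eq_square)
  moreover have "(a * \<bar>\<xi>\<bar>)\<^sup>2 \<le> c\<^sup>2 * \<xi>\<^sup>2"
    using power_mono[OF assms(2,1), of 2] by (simp add: power_mult_distrib mult_right_mono)
  moreover have "(a * \<bar>\<xi>\<bar> / 2 + c\<^sup>2 / 2)\<^sup>2 = (a * \<bar>\<xi>\<bar>)\<^sup>2 / 4 + c\<^sup>2 * (a * \<bar>\<xi>\<bar>) / 2 + c ^ 4 / 4"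
    by (simp add: power2_eq_square power4_eq_xxxx field_simps)
  moreover have "0 \<le> c\<^sup>2 * \<xi>\<^sup>2" by simp
  ultimately show "(a * \<bar>\<xi>\<bar> / 2 + c\<^sup>2 / 2)\<^sup>2 \<le> c\<^sup>2 * \<bar>\<xi>\<bar>\<^sup>2 + c ^ 4 / 4"
    unfolding power2_abs by linarith
qed

text \<open>Linear growth of the symbol is what makes \<open>sqrt_H\<close> meaningful on the Sobolev space of order
  one half.\<close>

lemma H_symbol_le:
  assumes "c \<ge> 0"
  shows "H_symbol c \<xi> \<le> c * \<bar>\<xi>\<bar>"
proof -
  have "sqrt (c\<^sup>2 * \<bar>\<xi>\<bar>\<^sup>2 + c ^ 4 / 4) \<le> sqrt (c\<^sup>2 * \<bar>\<xi>\<bar>\<^sup>2) + sqrt (c ^ 4 / 4)"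
    by (rule sqrt_add_le_add_sqrt) auto
  also have "sqrt (c\<^sup>2 * \<bar>\<xi>\<bar>\<^sup>2) = c * \<bar>\<xi>\<bar>" using assms by (simp add: real_sqrt_mult)
  also have "sqrt (c ^ 4 / 4) = c\<^sup>2 / 2"
    by (rule real_sqrt_unique) (auto simp: power_divide)
  finally show ?thesis by (simp add: H_symbol_def)
qed

lemma H_symbol_measurable [measurable]: "H_symbol c \<in> borel_measurable borel"
  unfolding H_symbol_def[abs_def] by measurable

section \<open>The interpolated inequality\<close>

theorem proposition2p1:
  fixes p c \<delta> :: real and u :: "real \<Rightarrow> complex"
  assumes "p > 1" and "c \<ge> 1" and "0 < \<delta>" and "\<delta> \<le> 1"
    and "in_Sobolev (1/2) u"
  shows "Lq_norm_pow (p + 1) u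
    \<le> C_GN p * ennreal
        (L2_norm u powr ((p + 3) / 2) * L2_norm (sqrt_H c (P_low (c * \<delta>) u)) powr ((p - 1) / 2)
         + 1 / (c * \<delta>) powr ((p - 1) / 2)
             * (L2_norm u)\<^sup>2 * L2_norm (sqrt_H c (P_high (c * \<delta>) u)) powr (p - 1))"
proof -
  define a where "a = c * \<delta>"
  have a: "0 < a" "a \<le> c" using assms by (auto simp: a_def mult_left_le)
  let ?\<sigma> = "\<lambda>\<xi>. complex_of_real (sqrt (H_symbol c \<xi>))"
  obtain v where v: "has_fourier_transform u v"
    and v_Sob: "(\<integral>\<^sup>+\<xi>. ennreal ((1 + \<xi>\<^sup>2) powr (1/2) * (cmod (v \<xi>))\<^sup>2) \<partial>lborel) < \<infinity>"
    using assms(5) unfolding in_Sobolev_def by blast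
  have v_L2: "in_L2 v" and [measurable]: "v \<in> borel_measurable borel"
    using v by (auto simp: has_fourier_transform_iff in_L2_iff)
  define lo where "lo \<xi> = indicator {\<xi>. \<bar>\<xi>\<bar> \<le> a} \<xi> * v \<xi>" for \<xi>
  define hi where "hi \<xi> = v \<xi> - lo \<xi>" for \<xi>
  have lo_le: "cmod (lo \<xi>) \<le> cmod (v \<xi>)" and hi_le: "cmod (hi \<xi>) \<le> cmod (v \<xi>)" for \<xi>
    by (auto simp: lo_def hi_def indicator_def)
  have lo_supp: "\<bar>\<xi>\<bar> \<le> a" if "lo \<xi> \<noteq> 0" for \<xi>
    using that by (auto simp: lo_def indicator_def split: if_splits)
  have hi_supp: "\<bar>\<xi>\<bar> > a" if "hi \<xi> \<noteq> 0" for \<xi>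
    using that by (auto simp: hi_def lo_def indicator_def split: if_splits)
  have [measurable]: "lo \<in> borel_measurable borel" "hi \<in> borel_measurable borel"
    unfolding lo_def[abs_def] hi_def[abs_def] by measurable
  have lo_L2: "in_L2 lo"
    using v_L2 by (rule in_L2_dominated[where C = 1]) (use lo_le in auto)
  have ft_lo: "has_fourier_transform (P_low a u) lo"
    using has_fourier_transform_multiplier[OF v, of "indicator {\<xi>. \<bar>\<xi>\<bar> \<le> a}"] lo_L2
    by (simp add: P_low_def lo_def[abs_def])
  have ft_hi: "has_fourier_transform (P_high a u) hi"
    unfolding P_high_def hi_def[abs_def] by (rule has_fourier_transform_diff[OF v ft_lo])
  have Sob_mono: "(\<integral>\<^sup>+\<xi>. ennreal ((1 + \<xi>\<^sup>2) powr (1/2) * (cmod (w \<xi>))\<^sup>2) \<partial>lborel) < \<infinity>"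
    if "\<And>\<xi>. cmod (w \<xi>) \<le> cmod (v \<xi>)" for w
    by (rule le_less_trans[OF nn_integral_mono v_Sob])
      (intro ennreal_leI mult_left_mono power_mono that; simp)
  have \<sigma>_bound: "(cmod (?\<sigma> \<xi>))\<^sup>2 \<le> c * (1 + \<xi>\<^sup>2) powr (1/2)" for \<xi>
  proof -
    have "(cmod (?\<sigma> \<xi>))\<^sup>2 = H_symbol c \<xi>" using H_symbol_nonneg[of c \<xi>] by simp
    also have "\<dots> \<le> c * \<bar>\<xi>\<bar>" using assms(2) by (intro H_symbol_le) simp
    also have "\<dots> \<le> c * (1 + \<xi>\<^sup>2) powr (1/2)"
      using assms(2) abs_le_sqrt_1_sq[of \<xi>] by (intro mult_left_mono) (auto simp: powr_half_sqrt)
    finally show ?thesis .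
  qed
  have \<sigma>_L2: "in_L2 (\<lambda>\<xi>. ?\<sigma> \<xi> * w \<xi>)"
    if "has_fourier_transform f w" "\<And>\<xi>. cmod (w \<xi>) \<le> cmod (v \<xi>)" for f w
    by (rule in_L2_multiplier_Sobolev[OF that(1) _ Sob_mono[OF that(2)] _ _ \<sigma>_bound])
      (use assms(2) in auto)

  have lo_Sob: "in_Sobolev 1 (P_low a u)"
  proof -
    have "(\<integral>\<^sup>+\<xi>. ennreal ((1 + \<xi>\<^sup>2) powr 1 * (cmod (lo \<xi>))\<^sup>2) \<partial>lborel)
        \<le> (\<integral>\<^sup>+\<xi>. ennreal (1 + a\<^sup>2) * ennreal ((cmod (lo \<xi>))\<^sup>2) \<partial>lborel)"
    proof (rule nn_integral_mono)
      fix \<xi> :: real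
      show "ennreal ((1 + \<xi>\<^sup>2) powr 1 * (cmod (lo \<xi>))\<^sup>2) \<le> ennreal (1 + a\<^sup>2) * ennreal ((cmod (lo \<xi>))\<^sup>2)"
      proof (cases "lo \<xi> = 0")
        case False
        from power_mono[OF lo_supp[OF this], of 2] have "\<xi>\<^sup>2 \<le> a\<^sup>2" by simp
        then show ?thesis
          by (subst ennreal_mult[symmetric]) (auto intro!: ennreal_leI mult_right_mono)
      qed simp
    qed
    also have "\<dots> < \<infinity>"
      using lo_L2 by (simp add: nn_integral_cmult nn_integral_cmod_sq ennreal_mult_less_top)
    finally show ?thesis unfolding in_Sobolev_def using ft_lo by blast
  qed
  have hi_Sob: "in_Sobolev (1/2) (P_high a u)"
    unfolding in_Sobolev_def using ft_hi Sob_mono[OF hi_le] by blast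

  have lo_norm: "L2_norm (P_low a u) \<le> L2_norm u" and hi_norm: "L2_norm (P_high a u) \<le> L2_norm u"
    using L2_norm_le_fourier[OF ft_lo v, of 1] L2_norm_le_fourier[OF ft_hi v, of 1] lo_le hi_le by auto
  have dx_lo: "L2_norm (dx (P_low a u)) \<le> 2 * L2_norm (sqrt_H c (P_low a u))"
    unfolding dx_def sqrt_H_def
  proof (rule multiplier_norm_mono[OF ft_lo _ \<sigma>_L2[OF ft_lo lo_le]])
    show "in_L2 (\<lambda>\<xi>. (\<i> * complex_of_real \<xi>) * lo \<xi>)"
    proof (rule in_L2_dominated[OF lo_L2, of _ a])
      fix \<xi> show "cmod (\<i> * complex_of_real \<xi> * lo \<xi>) \<le> a * cmod (lo \<xi>)"
        using lo_supp[of \<xi>] by (cases "lo \<xi> = 0") (auto simp: norm_mult intro!: mult_right_mono)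
    qed measurable
    fix \<xi> assume "lo \<xi> \<noteq> 0"
    then have "\<bar>\<xi>\<bar> \<le> c" using lo_supp a by force
    then have "\<xi>\<^sup>2 \<le> 4 * H_symbol c \<xi>"
      using H_symbol_ge_low[of \<xi> c] H_symbol_nonneg[of c \<xi>] by linarith
    then have "sqrt (\<xi>\<^sup>2) \<le> sqrt (4 * H_symbol c \<xi>)" by (rule real_sqrt_le_mono)
    then show "cmod (\<i> * complex_of_real \<xi>) \<le> 2 * cmod (?\<sigma> \<xi>)"
      using H_symbol_nonneg[of c \<xi>] by (simp add: norm_mult real_sqrt_mult)
  qed simp
  have half_hi: "L2_norm (abs_dx_half (P_high a u)) \<le> sqrt (2 / a) * L2_norm (sqrt_H c (P_high a u))"
    unfolding abs_dx_half_def sqrt_H_def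
  proof (rule multiplier_norm_mono[OF ft_hi _ \<sigma>_L2[OF ft_hi hi_le]])
    show "in_L2 (\<lambda>\<xi>. complex_of_real (\<bar>\<xi>\<bar> powr (1/2)) * hi \<xi>)"
      by (rule in_L2_multiplier_Sobolev[OF ft_hi _ Sob_mono[OF hi_le], of _ 1])
        (auto simp: powr_half_sqrt abs_le_sqrt_1_sq)
    fix \<xi> assume "hi \<xi> \<noteq> 0"
    then have "a * \<bar>\<xi>\<bar> / 2 \<le> H_symbol c \<xi>"
      using hi_supp[of \<xi>] a by (intro H_symbol_ge_high) auto
    then have "\<bar>\<xi>\<bar> \<le> 2 / a * H_symbol c \<xi>" using a by (simp add: field_simps)
    then have "sqrt \<bar>\<xi>\<bar> \<le> sqrt (2 / a * H_symbol c \<xi>)" by (rule real_sqrt_le_mono)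
    then show "cmod (complex_of_real (\<bar>\<xi>\<bar> powr (1/2))) \<le> sqrt (2 / a) * cmod (?\<sigma> \<xi>)"
      using H_symbol_nonneg[of c \<xi>] by (simp add: powr_half_sqrt flip: real_sqrt_mult)
  qed (use a in simp)

  \<comment> \<open>\<open>K\<close> is the common price of the symbol bounds. In the low part the factor \<open>2\<close> in \<open>dx_lo\<close>
    (instead of the \<open>\<surd>2\<close> that the symbol bound gives) produces exactly \<open>K\<close>; in the high part it comes
    from \<open>\<surd>(2/a)\<close> to the power \<open>p - 1\<close>, whose denominator goes into \<open>B\<close>.\<close>
  define A where "A = L2_norm u powr ((p + 3) / 2) * L2_norm (sqrt_H c (P_low a u)) powr ((p - 1) / 2)"
  define B where "B = 1 / a powr ((p - 1) / 2) * (L2_norm u)\<^sup>2 * L2_norm (sqrt_H c (P_high a u)) powr (p - 1)"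
  define K where "K = (2::real) powr ((p - 1) / 2)"
  have nonneg: "A \<ge> 0" "B \<ge> 0" "K \<ge> 0" by (auto simp: A_def B_def K_def)
  have low: "Lq_norm_pow (p + 1) (P_low a u) \<le> GN_const_one p * ennreal (K * A)"
  proof (rule order_trans[OF gagliardo_nirenberg_one[OF assms(1) lo_Sob]], intro mult_left_mono ennreal_leI)
    have "L2_norm (dx (P_low a u)) powr ((p - 1) / 2)
        \<le> (2 * L2_norm (sqrt_H c (P_low a u))) powr ((p - 1) / 2)"
      using assms(1) by (intro powr_mono2 dx_lo) auto
    also have "\<dots> = K * L2_norm (sqrt_H c (P_low a u)) powr ((p - 1) / 2)"
      by (simp add: K_def powr_mult)
    finally have "L2_norm (P_low a u) powr ((p + 3) / 2) * L2_norm (dx (P_low a u)) powr ((p - 1) / 2)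
        \<le> L2_norm u powr ((p + 3) / 2) * (K * L2_norm (sqrt_H c (P_low a u)) powr ((p - 1) / 2))"
      using assms(1) by (intro mult_mono powr_mono2 lo_norm) auto
    then show "L2_norm (P_low a u) powr ((p + 3) / 2) * L2_norm (dx (P_low a u)) powr ((p - 1) / 2) \<le> K * A"
      by (simp add: A_def mult_ac)
  qed simp
  have high: "Lq_norm_pow (p + 1) (P_high a u) \<le> GN_const_half p * ennreal (K * B)"
  proof (rule order_trans[OF gagliardo_nirenberg_half[OF assms(1) hi_Sob]], intro mult_left_mono ennreal_leI)
    have "L2_norm (abs_dx_half (P_high a u)) powr (p - 1)
        \<le> (sqrt (2 / a) * L2_norm (sqrt_H c (P_high a u))) powr (p - 1)"
      using assms(1) by (intro powr_mono2 half_hi) auto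
    also have "\<dots> = (2 / a) powr ((p - 1) / 2) * L2_norm (sqrt_H c (P_high a u)) powr (p - 1)"
      using a by (simp add: powr_mult powr_half_sqrt[symmetric] powr_powr)
    also have "\<dots> = K / a powr ((p - 1) / 2) * L2_norm (sqrt_H c (P_high a u)) powr (p - 1)"
      using a by (simp add: K_def powr_divide)
    finally have "(L2_norm (P_high a u))\<^sup>2 * L2_norm (abs_dx_half (P_high a u)) powr (p - 1)
        \<le> (L2_norm u)\<^sup>2 * (K / a powr ((p - 1) / 2) * L2_norm (sqrt_H c (P_high a u)) powr (p - 1))"
      by (intro mult_mono power_mono hi_norm) auto
    then show "(L2_norm (P_high a u))\<^sup>2 * L2_norm (abs_dx_half (P_high a u)) powr (p - 1) \<le> K * B"
      by (simp add: B_def mult_ac)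
  qed simp

  let ?M = "max (GN_const_one p) (GN_const_half p)"
  have "Lq_norm_pow (p + 1) u = Lq_norm_pow (p + 1) (\<lambda>x. P_low a u x + P_high a u x)"
    by (simp add: P_high_def)
  also have "\<dots> \<le> ennreal (2 powr p) * (Lq_norm_pow (p + 1) (P_low a u) + Lq_norm_pow (p + 1) (P_high a u))"
    using Lq_norm_pow_add_le[of "P_low a u" "P_high a u" "p + 1"] ft_lo ft_hi assms(1)
    by (simp add: has_fourier_transform_iff in_L2_iff)
  also have "\<dots> \<le> ennreal (2 powr p) * (?M * ennreal (K * A) + ?M * ennreal (K * B))"
    by (intro mult_left_mono add_mono order_trans[OF low] order_trans[OF high] mult_right_mono) auto
  also have "\<dots> = ennreal (2 powr p * K) * ?M * ennreal (A + B)"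
    using nonneg by (simp add: ennreal_mult ennreal_plus distrib_left distrib_right mult_ac)
  also have "2 powr p * K = 2 powr ((3 * p - 1) / 2)"
    by (simp add: K_def powr_add[symmetric] field_simps)
  finally show ?thesis unfolding C_GN_def A_def B_def a_def .
qed

end
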